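(* Let $M$ be a connected piecewise flat Landsberg surface. Then for $x\in M$ which is not a vertex, $l_x^\pm(\mathcal S_x^\pm M)$ is a constant; that is, there is a number $\theta_M$ such that $l_x^+(\mathcal S_x^+M)=l_x^-(\mathcal S_x^-M)=\theta_M$ for every $x\in M$ which is not a vertex.
   Context: A Minkowski norm on a finite-dimensional real vector space $V$ is a continuous $F:V\to[0,\infty)$, smooth and positive on $V\setminus\{0\}$, with $F(\lambda y)=\lambda F(y)$ for $\lambda\ge0$, such that for every $y\ne0$ the bilinear form $\langle u,v\rangle^F_y=\frac12\frac{\partial^2}{\partial s\partial t}F^2(y+su+tv)|_{s=t=0}$ is positive definite ($F(-y)=F(y)$ is not required). A Minkowski plane is $\mathbb R^2$ with the translation-invariant Finsler metric given by a Minkowski norm. A piecewise flat Finsler surface is a surface $M$ (without boundary) with a locally finite triangulation $M=\bigcup T_i$ by closed triangles, different triangles being disjoint or meeting in exactly one common edge or one common vertex, where each $T_i$ carries a flat metric $F_i$ such that $(T_i,F_i)$ is isometric to a straight-edged triangle in a Minkowski plane, and $F_i,F_j$ coincide on a common edge of $T_i,T_j$. Tangent cone: let $(T_1,F_1),\dots,(T_n,F_n)$ be the closed triangles containing $x$. Each is enlarged to a Minkowski cone $C_{x,i}$ with vertex $x$ (the planar sector at $x$ spanned by $T_i$; a half plane if $x$ is an edge point but not a vertex, the whole plane if $x$ is interior to a triangle) with $F_i$ extended to it; $T_xM=\bigcup_i C_{x,i}$, glued along common boundary rays. An outgoing (incoming) tangent vector at $x$ is an arrow in some $C_{x,i}$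 starting (ending) at $x$. $\mathcal S^+_{x,i}M$ ($\mathcal S^-_{x,i}M$) is the set of outgoing (incoming) vectors at $x$ in $C_{x,i}$ with $F_i=1$; $\mathcal S_x^\pm M=\bigcup_i\mathcal S_{x,i}^\pm M$ are circles, with arc length functional $l_x^\pm$ given on $\mathcal S_{x,i}^\pm M$ by the metric $\langle\cdot,\cdot\rangle^{F_i}_y$ at $y$. $M$ is a piecewise flat Landsberg surface if for any $x$ on an edge $E$ between two triangles $(T_1,F_1)$ and $(T_2,F_2)$ of $M$, $x$ not a vertex, the homeomorphism $\mathcal S_{x,1}^-M\to\mathcal S_{x,2}^+M$, $u_1^-\mapsto u_2^+$, defined by $\langle u_1^-,v\rangle^{F_1}_{u_1^-}=\langle u_2^+,v\rangle^{F_2}_{u_2^+}$, with $v$ any nonzero vector in the direction of $E$, is an isometry for the metrics on the indicatrices defined by $\langle\cdot,\cdot\rangle^{F_i}_y$. (The roles of $T_1$ and $T_2$ can be switched.) *)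

theory Defs
  imports "HOL-Analysis.Analysis"
begin

section \<open>Minkowski norms\<close>

primrec Ck_on :: "nat \<Rightarrow> 'a::euclidean_space set \<Rightarrow> ('a \<Rightarrow> real) \<Rightarrow> bool" where
  "Ck_on 0 S f \<longleftrightarrow> continuous_on S f"
| "Ck_on (Suc k) S f \<longleftrightarrow> (\<forall>x\<in>S. f differentiable (at x)) \<and>
     (\<forall>v. Ck_on k S (\<lambda>x. frechet_derivative f (at x) v))"

text \<open>Meant for open \<open>S\<close> only, since the derivatives are two-sided.\<close>

definition smooth_on :: "'a::euclidean_space set \<Rightarrow> ('a \<Rightarrow> real) \<Rightarrow> bool" where
  "smooth_on S f \<longleftrightarrow> (\<forall>k. Ck_on k S f)"

text \<open>\<open>fund F y u v\<close> is the bilinear form $\langle u,v\rangle^F_y$.\<close>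

definition fund :: "('a::euclidean_space \<Rightarrow> real) \<Rightarrow> 'a \<Rightarrow> 'a \<Rightarrow> 'a \<Rightarrow> real" where
  "fund F y u v =
     1/2 * deriv (\<lambda>s. deriv (\<lambda>t. (F (y + s *\<^sub>R u + t *\<^sub>R v))\<^sup>2) 0) 0"

definition minkowski_norm :: "('a::euclidean_space \<Rightarrow> real) \<Rightarrow> bool" where
  "minkowski_norm F \<longleftrightarrow>
     continuous_on UNIV F \<and> (\<forall>y. 0 \<le> F y) \<and>
     smooth_on (UNIV - {0}) F \<and> (\<forall>y. y \<noteq> 0 \<longrightarrow> 0 < F y) \<and>
     (\<forall>c y. 0 \<le> c \<longrightarrow> F (c *\<^sub>R y) = c * F y) \<and>
     (\<forall>y u. y \<noteq> 0 \<longrightarrow> u \<noteq> 0 \<longrightarrow> 0 < fund F y u u)"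


section \<open>Arc length and isometries of indicatrices in a Minkowski plane\<close>

text \<open>
  The indicatrix of \<open>F\<close>, parametrized by the polar angle, and the arc length of a (Borel)
  subset \<open>A\<close> of the indicatrix for the Riemannian metric given by \<open>fund F y\<close> at \<open>y\<close>.
\<close>

definition polar :: "(real^2 \<Rightarrow> real) \<Rightarrow> real \<Rightarrow> real^2" where
  "polar F t = (1 / F (vector [cos t, sin t])) *\<^sub>R vector [cos t, sin t]"

definition arc_length :: "(real^2 \<Rightarrow> real) \<Rightarrow> (real^2) set \<Rightarrow> real" where
  "arc_length F A =
     integral {t \<in> {0..2*pi}. polar F t \<in> A}
       (\<lambda>t. sqrt (fund F (polar F t) (vector_derivative (polar F) (at t))
                                    (vector_derivative (polar F) (at t))))"

text \<open>
  Riemannian isometry between arcs \<open>S1\<close>, \<open>S2\<close> of the indicatrices of \<open>F1\<close>, \<open>F2\<close>.  The tangent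
  line of the indicatrix at \<open>u\<close> is the kernel of the differential of \<open>F1\<close> at \<open>u\<close>.  The derivative
  is taken within \<open>S1\<close>, hence is one-sided at the end points of an arc; only its (uniquely
  determined) restriction to the tangent line is used.
\<close>

definition indicatrix_isometry ::
  "(real^2 \<Rightarrow> real) \<Rightarrow> (real^2) set \<Rightarrow> (real^2 \<Rightarrow> real) \<Rightarrow> (real^2) set \<Rightarrow> (real^2 \<Rightarrow> real^2) \<Rightarrow> bool"
where
  "indicatrix_isometry F1 S1 F2 S2 h \<longleftrightarrow>
     (\<exists>k. homeomorphism S1 S2 h k) \<and>
     (\<forall>u\<in>S1. \<exists>D. (h has_derivative D) (at u within S1) \<and>
        (\<forall>w. frechet_derivative F1 (at u) w = 0 \<longrightarrow>
              fund F2 (h u) (D w) (D w) = fund F1 u w w))"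


section \<open>Piecewise flat Finsler surfaces\<close>

definition topological_surface :: "'a topology \<Rightarrow> bool" where
  "topological_surface X \<longleftrightarrow>
     Hausdorff_space X \<and> second_countable X \<and>
     (\<forall>x\<in>topspace X. \<exists>U V. openin X U \<and> x \<in> U \<and> open (V :: (real^2) set) \<and>
        subtopology X U homeomorphic_space subtopology euclidean V)"

text \<open>
  A triangle \<open>T\<close> is a set of points of the surface.  Its flat metric is given by the Minkowski
  norm \<open>fnorm M T\<close> on the plane together with the isometry \<open>chart M T\<close> of \<open>T\<close> onto a
  straight-edged triangle in that Minkowski plane.
\<close>

record 'a pf_surface =
  topo :: "'a topology"
  triangles :: "'a set set"
  chart :: "'a set \<Rightarrow> 'a \<Rightarrow> real^2"
  fnorm :: "'a set \<Rightarrow> real^2 \<Rightarrow> real"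

definition vertex_of :: "'a pf_surface \<Rightarrow> 'a set \<Rightarrow> 'a \<Rightarrow> bool" where
  "vertex_of M T x \<longleftrightarrow> x \<in> T \<and> chart M T x extreme_point_of (chart M T ` T)"

definition is_vertex :: "'a pf_surface \<Rightarrow> 'a \<Rightarrow> bool" where
  "is_vertex M x \<longleftrightarrow> (\<exists>T\<in>triangles M. vertex_of M T x)"

definition is_edge_of :: "'a pf_surface \<Rightarrow> 'a set \<Rightarrow> 'a set \<Rightarrow> bool" where
  "is_edge_of M T E \<longleftrightarrow> E \<subseteq> T \<and> (chart M T ` E) edge_of (chart M T ` T)"

definition share_edge :: "'a pf_surface \<Rightarrow> 'a set \<Rightarrow> 'a set \<Rightarrow> bool" where
  "share_edge M T T' \<longleftrightarrow> T \<noteq> T' \<and> is_edge_of M T (T \<inter> T') \<and> is_edge_of M T' (T \<inter> T')"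

definition share_vertex :: "'a pf_surface \<Rightarrow> 'a set \<Rightarrow> 'a set \<Rightarrow> bool" where
  "share_vertex M T T' \<longleftrightarrow> T \<noteq> T' \<and> (\<exists>x. T \<inter> T' = {x} \<and> vertex_of M T x \<and> vertex_of M T' x)"

text \<open>
  The last condition says that the two metrics coincide on a common edge: they assign the same
  (directed) length to every oriented segment of it.  In particular the change of charts along
  the edge is affine.
\<close>

definition pf_finsler_surface :: "'a pf_surface \<Rightarrow> bool" where
  "pf_finsler_surface M \<longleftrightarrow>
     topological_surface (topo M) \<and>
     \<Union> (triangles M) = topspace (topo M) \<and>
     locally_finite_in (topo M) (triangles M) \<and>
     (\<forall>T\<in>triangles M.
        minkowski_norm (fnorm M T) \<and>
        2 simplex (chart M T ` T) \<and>
        homeomorphic_map (subtopology (topo M) T)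
          (subtopology euclidean (chart M T ` T)) (chart M T)) \<and>
     (\<forall>T\<in>triangles M. \<forall>T'\<in>triangles M. T \<noteq> T' \<longrightarrow>
        T \<inter> T' = {} \<or> share_edge M T T' \<or> share_vertex M T T') \<and>
     (\<forall>T\<in>triangles M. \<forall>T'\<in>triangles M. share_edge M T T' \<longrightarrow>
        (\<forall>p\<in>T \<inter> T'. \<forall>q\<in>T \<inter> T'.
           fnorm M T (chart M T q - chart M T p) = fnorm M T' (chart M T' q - chart M T' p)))"


section \<open>Tangent cones and their indicatrices\<close>

text \<open>The Minkowski cone at \<open>x\<close>, translated such that its vertex \<open>x\<close> becomes the origin.\<close>

definition tcone :: "'a pf_surface \<Rightarrow> 'a \<Rightarrow> 'a set \<Rightarrow> (real^2) set" where
  "tcone M x T = {v. \<exists>t>0. chart M T x + t *\<^sub>R v \<in> chart M T ` T}"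

definition star :: "'a pf_surface \<Rightarrow> 'a \<Rightarrow> 'a set set" where
  "star M x = {T \<in> triangles M. x \<in> T}"

definition out_ind :: "'a pf_surface \<Rightarrow> 'a \<Rightarrow> 'a set \<Rightarrow> (real^2) set" where
  "out_ind M x T = {v. v \<in> tcone M x T \<and> fnorm M T v = 1}"

text \<open>An incoming vector is an arrow ending at \<open>x\<close>, so it is its starting point \<open>- v\<close> that lies
  in the cone.\<close>

definition in_ind :: "'a pf_surface \<Rightarrow> 'a \<Rightarrow> 'a set \<Rightarrow> (real^2) set" where
  "in_ind M x T = {v. - v \<in> tcone M x T \<and> fnorm M T v = 1}"

text \<open>\<open>v\<close> and \<open>v'\<close> are the expressions in the charts of \<open>T\<close> and \<open>T'\<close> of one vector in the direction
  of a common edge through \<open>x\<close>.\<close>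

definition edge_vec :: "'a pf_surface \<Rightarrow> 'a \<Rightarrow> 'a set \<Rightarrow> 'a set \<Rightarrow> real^2 \<Rightarrow> real^2 \<Rightarrow> bool" where
  "edge_vec M x T T' v v' \<longleftrightarrow>
     (\<exists>p\<in>T \<inter> T'. \<exists>t::real. v = t *\<^sub>R (chart M T p - chart M T x) \<and>
                          v' = t *\<^sub>R (chart M T' p - chart M T' x))"

text \<open>Gluing of the cones along common boundary rays; a pair \<open>(T, v)\<close> is a vector \<open>v\<close> of the cone
  of \<open>T\<close>, outgoing or incoming.\<close>

definition glue :: "'a pf_surface \<Rightarrow> 'a \<Rightarrow> (('a set \<times> (real^2)) \<times> ('a set \<times> (real^2))) set" where
  "glue M x = {((T, v), (T', v')). T \<in> star M x \<and> T' \<in> star M x \<and>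
                 (T = T' \<and> v = v' \<or> edge_vec M x T T' v v')}"

definition S_out :: "'a pf_surface \<Rightarrow> 'a \<Rightarrow> ('a set \<times> (real^2)) set set" where
  "S_out M x = (SIGMA T:star M x. out_ind M x T) // glue M x"

definition S_in :: "'a pf_surface \<Rightarrow> 'a \<Rightarrow> ('a set \<times> (real^2)) set set" where
  "S_in M x = (SIGMA T:star M x. in_ind M x T) // glue M x"

text \<open>
  The arc length functionals on \<open>S_out M x\<close> and \<open>S_in M x\<close>: the length of \<open>A\<close> is the sum of the
  lengths of its parts in the individual cones, as distinct parts overlap in finitely many points.
\<close>

definition l_out :: "'a pf_surface \<Rightarrow> 'a \<Rightarrow> ('a set \<times> (real^2)) set set \<Rightarrow> real" where
  "l_out M x A =
     (\<Sum>T\<in>star M x. arc_length (fnorm M T) {v \<in> out_ind M x T. glue M x `` {(T, v)} \<in> A})"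

definition l_in :: "'a pf_surface \<Rightarrow> 'a \<Rightarrow> ('a set \<times> (real^2)) set set \<Rightarrow> real" where
  "l_in M x A =
     (\<Sum>T\<in>star M x. arc_length (fnorm M T) {v \<in> in_ind M x T. glue M x `` {(T, v)} \<in> A})"


section \<open>Piecewise flat Landsberg surfaces\<close>

text \<open>The map \<open>h\<close> is uniquely determined on \<open>in_ind M x T1\<close> by the displayed equation.  Both
  orders of each pair of triangles are covered by the quantifiers.\<close>

definition pf_landsberg_surface :: "'a pf_surface \<Rightarrow> bool" where
  "pf_landsberg_surface M \<longleftrightarrow>
     pf_finsler_surface M \<and>
     (\<forall>T1\<in>triangles M. \<forall>T2\<in>triangles M. share_edge M T1 T2 \<longrightarrow>
        (\<forall>x\<in>T1 \<inter> T2. \<not> is_vertex M x \<longrightarrow>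
           (\<exists>h. (\<forall>u\<in>in_ind M x T1. \<forall>v1 v2. edge_vec M x T1 T2 v1 v2 \<and> v1 \<noteq> 0 \<longrightarrow>
                   fund (fnorm M T1) u u v1 = fund (fnorm M T2) (h u) (h u) v2) \<and>
                indicatrix_isometry (fnorm M T1) (in_ind M x T1)
                  (fnorm M T2) (out_ind M x T2) h)))"

end

theory Submission
  imports Defs
begin

text \<open>
  The constant is the full length of the indicatrix of \<open>F\<^sub>i\<close>, which does not depend on the triangle
  \<open>T\<^sub>i\<close>.  At an interior point of a triangle both indicatrices are the full indicatrix.  A point on an
  edge that is not a vertex lies in exactly two triangles, whose cones there are half planes; the
  incoming half of either indicatrix has the same length as the outgoing half of the other one by the
  Landsberg condition, so both \<open>l\<^sup>\<plusminus>\<close> equal the full indicatrix length of either triangle.  Since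
  removing isolated points does not disconnect a connected surface, all triangles are linked through
  common edges.
\<close>

section \<open>The fundamental tensor\<close>

text \<open>Three obstacles shape the development. The Landsberg condition hands over an abstract
  bijection of arcs whose derivative is known only within the arc, whereas length is an integral
  over the polar angle; so the isometry is rewritten as a monotone function between two angle
  intervals, and the comparison of lengths becomes an application of the fundamental theorem of
  calculus. Next, \<open>F\<close> need not be even, so the two halves of one indicatrix can differ
  in length and only their sum is the same for all directions of the dividing line. The number of
  triangles at a point is not part of the definitions either: it is forced by the surface being
  locally planar, through invariance of domain. Finally, the Landsberg condition says nothing at a
  vertex, where triangles may meet without sharing an edge, so the global argument must pass around
  vertices inside punctured discs.\<close>

abbreviation dir :: "('a::euclidean_space \<Rightarrow> real) \<Rightarrow> 'a \<Rightarrow> 'a \<Rightarrow> real" where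
  "dir f v y \<equiv> frechet_derivative f (at y) v"

lemma smooth_on_continuous: "smooth_on S f \<Longrightarrow> continuous_on S f"
  unfolding smooth_on_def by (metis Ck_on.simps(1))

lemma smooth_on_differentiable: "smooth_on S f \<Longrightarrow> x \<in> S \<Longrightarrow> f differentiable (at x)"
  unfolding smooth_on_def by (metis Ck_on.simps(2))

lemma smooth_on_dir: "smooth_on S f \<Longrightarrow> smooth_on S (dir f v)"
  unfolding smooth_on_def by (metis Ck_on.simps(2))

lemma smooth_on_has_derivative:
  "smooth_on S f \<Longrightarrow> x \<in> S \<Longrightarrow> (f has_derivative (\<lambda>v. dir f v x)) (at x)"
  using smooth_on_differentiable frechet_derivative_works by blast

lemma smooth_on_DERIV_line:
  assumes "smooth_on S f" "y \<in> S"
  shows "((\<lambda>t. f (y + t *\<^sub>R v)) has_real_derivative dir f v y) (at 0)"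
proof -
  have f: "(f has_derivative (\<lambda>v. dir f v y)) (at (y + 0 *\<^sub>R v))"
    using smooth_on_has_derivative[OF assms] by simp
  have l: "((\<lambda>t. y + t *\<^sub>R v) has_derivative (\<lambda>t. t *\<^sub>R v)) (at 0)"
    by (auto intro!: derivative_eq_intros)
  have "linear (\<lambda>v. dir f v y)"
    using smooth_on_has_derivative[OF assms] has_derivative_linear by blast
  from linear_scale[OF this] have "(\<lambda>t. dir f (t *\<^sub>R v) y) = (*) (dir f v y)"
    by (simp add: fun_eq_iff)
  then show ?thesis
    using has_derivative_compose[OF l f] by (simp add: has_field_derivative_def)
qed

lemma linear_dir:
  "smooth_on S f \<Longrightarrow> y \<in> S \<Longrightarrow> linear (\<lambda>v. dir f v y)"
  using smooth_on_has_derivative has_derivative_linear by blast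

lemma dir_euclidean_expansion:
  assumes "smooth_on S f" "y \<in> S"
  shows "dir f v y = (\<Sum>b\<in>Basis. (v \<bullet> b) * dir f b y)"
proof -
  have "dir f (\<Sum>b\<in>Basis. (v \<bullet> b) *\<^sub>R b) y = (\<Sum>b\<in>Basis. (v \<bullet> b) * dir f b y)"
    by (simp add: linear_sum[OF linear_dir[OF assms]] linear_scale[OF linear_dir[OF assms]])
  then show ?thesis by (simp add: euclidean_representation)
qed

text \<open>Smoothness gives continuity of \<open>dir f b\<close> for a fixed direction
  \<open>b\<close>. Here the direction moves together with the point, so it is expanded in
  \<open>Basis\<close> with continuous coefficients.\<close>

lemma continuous_on_dir:
  assumes "smooth_on S f" "continuous_on I p" "continuous_on I w" "p ` I \<subseteq> S"
  shows "continuous_on I (\<lambda>t. dir f (w t) (p t))"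
proof -
  have "continuous_on I (\<lambda>t. dir f b (p t))" for b
    using smooth_on_continuous[OF smooth_on_dir[OF assms(1)]] assms(2,4)
    by (rule continuous_on_compose2)
  then have "continuous_on I (\<lambda>t. \<Sum>b\<in>Basis. (w t \<bullet> b) * dir f b (p t))"
    by (intro continuous_on_sum continuous_on_mult continuous_on_inner continuous_on_const assms(3))
  then show ?thesis
    by (rule continuous_on_eq) (metis dir_euclidean_expansion[OF assms(1)] assms(4) image_subset_iff)
qed

text \<open>Linearity in the outer direction \<open>u\<close> is part of being a derivative. In the
  inner direction \<open>v\<close> it comes from differentiating the identities that express
  linearity of \<open>dir f v x\<close> in \<open>v\<close>; these hold at all points of the open
  set \<open>S\<close>, hence near \<open>y\<close>.\<close>

lemma dir_linear_dir:
  assumes "smooth_on S f" "open S" "y \<in> S"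
  shows "linear (\<lambda>v. dir (dir f v) u y)"
proof -
  have d: "((dir f v) has_derivative (\<lambda>u. dir (dir f v) u y)) (at y)" for v
    using smooth_on_has_derivative[OF smooth_on_dir] assms by blast
  show ?thesis
  proof (rule linearI)
    fix v w
    have "((\<lambda>x. dir f v x + dir f w x) has_derivative
            (\<lambda>u. dir (dir f v) u y + dir (dir f w) u y)) (at y)"
      by (intro has_derivative_add d)
    moreover have "dir f v x + dir f w x = dir f (v + w) x" if "x \<in> S" for x
      by (rule linear_add[OF linear_dir[OF assms(1) that], symmetric])
    ultimately have "(dir f (v + w) has_derivative
            (\<lambda>u. dir (dir f v) u y + dir (dir f w) u y)) (at y)"
      by (rule has_derivative_transform_within_open[OF _ assms(2,3)])
    from fun_cong[OF has_derivative_unique[OF d this]]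
    show "dir (dir f (v + w)) u y = dir (dir f v) u y + dir (dir f w) u y" .
  next
    fix c v
    have "((\<lambda>x. c *\<^sub>R dir f v x) has_derivative (\<lambda>u. c *\<^sub>R dir (dir f v) u y)) (at y)"
      by (intro has_derivative_scaleR_right d)
    moreover have "c *\<^sub>R dir f v x = dir f (c *\<^sub>R v) x" if "x \<in> S" for x
      by (rule linear_scale[OF linear_dir[OF assms(1) that], symmetric])
    ultimately have "(dir f (c *\<^sub>R v) has_derivative (\<lambda>u. c *\<^sub>R dir (dir f v) u y)) (at y)"
      by (rule has_derivative_transform_within_open[OF _ assms(2,3)])
    from fun_cong[OF has_derivative_unique[OF d this]]
    show "dir (dir f (c *\<^sub>R v)) u y = c *\<^sub>R dir (dir f v) u y" .
  qed
qed

lemma continuous_on_dir_dir: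
  assumes "smooth_on S f" "open S" "continuous_on I p" "continuous_on I w" "continuous_on I u"
    and "p ` I \<subseteq> S"
  shows "continuous_on I (\<lambda>t. dir (dir f (w t)) (u t) (p t))"
proof -
  have "continuous_on I (\<lambda>t. \<Sum>b\<in>Basis. (w t \<bullet> b) * dir (dir f b) (u t) (p t))"
    by (intro continuous_on_sum continuous_on_mult continuous_on_inner continuous_on_const assms
        continuous_on_dir[OF smooth_on_dir[OF assms(1)]])
  moreover have "(\<Sum>b\<in>Basis. (w t \<bullet> b) * dir (dir f b) (u t) (p t)) =
      dir (dir f (w t)) (u t) (p t)" if "t \<in> I" for t
  proof -
    have "dir (dir f (\<Sum>b\<in>Basis. (w t \<bullet> b) *\<^sub>R b)) (u t) (p t) =
        (\<Sum>b\<in>Basis. (w t \<bullet> b) * dir (dir f b) (u t) (p t))"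
      using linear_sum[OF dir_linear_dir[OF assms(1,2), of "p t" "u t"],
          of "\<lambda>b. (w t \<bullet> b) *\<^sub>R b" Basis]
        linear_scale[OF dir_linear_dir[OF assms(1,2), of "p t" "u t"]] assms(6) that
      by (auto simp: image_subset_iff)
    then show ?thesis by (simp add: euclidean_representation)
  qed
  ultimately show ?thesis
    by (rule continuous_on_eq)
qed

section \<open>The fundamental tensor of a Minkowski norm in terms of directional
  derivatives\<close>

lemma minkowski_norm_smooth: "minkowski_norm F \<Longrightarrow> smooth_on (UNIV - {0}) F"
  and minkowski_norm_pos: "minkowski_norm F \<Longrightarrow> y \<noteq> 0 \<Longrightarrow> 0 < F y"
  and minkowski_norm_scale: "minkowski_norm F \<Longrightarrow> 0 \<le> c \<Longrightarrow> F (c *\<^sub>R y) = c * F y"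
  by (auto simp: minkowski_norm_def)

text \<open>The product rule, applied twice to \<open>F\<^sup>2\<close>. It trades the nested
  \<open>deriv\<close> for directional derivatives, whose linearity and continuity are
  available.\<close>

lemma fund_eq:
  assumes F: "minkowski_norm F" and y: "y \<noteq> 0"
  shows "fund F y u v = dir F u y * dir F v y + F y * dir (dir F v) u y"
proof -
  note sm = minkowski_norm_smooth[OF F]
  have inner: "((\<lambda>t. (F (z + t *\<^sub>R v))\<^sup>2) has_real_derivative 2 * F z * dir F v z) (at 0)"
    if "z \<noteq> 0" for z
    using smooth_on_DERIV_line[OF sm, of z v] that by (auto intro!: derivative_eq_intros)
  have "((\<lambda>s. y + s *\<^sub>R u) \<longlongrightarrow> y + 0 *\<^sub>R u) (nhds 0)"
    by (intro tendsto_intros filterlim_ident)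
  then have "((\<lambda>s. y + s *\<^sub>R u) \<longlongrightarrow> y) (nhds 0)"
    by simp
  then have "\<forall>\<^sub>F s in nhds 0. y + s *\<^sub>R u \<in> UNIV - {0}"
    by (rule topological_tendstoD) (use y in auto)
  \<comment> \<open>The outer derivative sees the inner one at all nearby base points, so the inner
    formula is needed for all \<open>s\<close> near 0, where the base point still avoids the
    origin.\<close>
  then have "\<forall>\<^sub>F s in nhds 0. deriv (\<lambda>t. (F (y + s *\<^sub>R u + t *\<^sub>R v))\<^sup>2) 0 =
      2 * F (y + s *\<^sub>R u) * dir F v (y + s *\<^sub>R u)"
    by eventually_elim (use inner DERIV_imp_deriv in blast)
  from deriv_cong_ev[OF this refl] have "fund F y u v =
      1/2 * deriv (\<lambda>s. 2 * F (y + s *\<^sub>R u) * dir F v (y + s *\<^sub>R u)) 0"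
    unfolding fund_def by (simp only:)
  also have "deriv (\<lambda>s. 2 * F (y + s *\<^sub>R u) * dir F v (y + s *\<^sub>R u)) 0 =
      2 * (dir F u y * dir F v y + F y * dir (dir F v) u y)"
  proof (rule DERIV_imp_deriv)
    show "((\<lambda>s. 2 * F (y + s *\<^sub>R u) * dir F v (y + s *\<^sub>R u)) has_real_derivative
        2 * (dir F u y * dir F v y + F y * dir (dir F v) u y)) (at 0)"
      using smooth_on_DERIV_line[OF sm, of y u] smooth_on_DERIV_line[OF smooth_on_dir[OF sm], of y u v] y
      by (auto intro!: derivative_eq_intros simp: algebra_simps)
  qed
  finally show ?thesis by simp
qed

lemma fund_scale:
  assumes "minkowski_norm F" "y \<noteq> 0"
  shows "fund F y (c *\<^sub>R u) (c *\<^sub>R u) = c\<^sup>2 * fund F y u u"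
proof -
  note sm = minkowski_norm_smooth[OF assms(1)]
  have y: "y \<in> UNIV - {0}" and o: "open (UNIV - {0 :: 'a})"
    using assms by auto
  show ?thesis
    unfolding fund_eq[OF assms] linear_scale[OF linear_dir[OF sm y]]
      linear_scale[OF dir_linear_dir[OF sm o y]] linear_scale[OF linear_dir[OF smooth_on_dir[OF sm] y]]
    by (simp add: power2_eq_square algebra_simps)
qed

lemma continuous_on_fund:
  assumes F: "minkowski_norm F" and "continuous_on I p" "continuous_on I u" "continuous_on I w"
    and ne: "\<And>t. t \<in> I \<Longrightarrow> p t \<noteq> 0"
  shows "continuous_on I (\<lambda>t. fund F (p t) (u t) (w t))"
proof -
  note sm = minkowski_norm_smooth[OF F]
  have "continuous_on I (\<lambda>t. dir F (u t) (p t) * dir F (w t) (p t) +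
      F (p t) * dir (dir F (w t)) (u t) (p t))"
    using ne by (intro continuous_on_add continuous_on_mult continuous_on_dir[OF sm] assms
        continuous_on_dir_dir[OF sm] continuous_on_compose2[OF smooth_on_continuous[OF sm] assms(2)]) auto
  then show ?thesis
    by (rule continuous_on_eq) (simp add: fund_eq[OF F ne])
qed

section \<open>Arc length of half indicatrices\<close>

abbreviation cis2 :: "real \<Rightarrow> real^2" where
  "cis2 t \<equiv> vector [cos t, sin t]"

lemma inner_vec2: "(v::real^2) \<bullet> w = v $ 1 * w $ 1 + v $ 2 * w $ 2"
  by (simp add: inner_vec_def sum_2)

lemma norm_cis2 [simp]: "norm (cis2 t) = 1"
  by (simp add: norm_eq_sqrt_inner inner_vec2 flip: power2_eq_square)

lemma cis2_nonzero [simp]: "cis2 t \<noteq> 0"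
  using norm_cis2[of t] by force

lemma cis2_has_vector_derivative: "(cis2 has_vector_derivative vector [- sin t, cos t]) (at t)"
proof -
  have *: "(vector [a, b] :: real^2) = a *\<^sub>R axis 1 1 + b *\<^sub>R axis 2 1" for a b
    by (simp add: vec_eq_iff forall_2 axis_def)
  show ?thesis
    unfolding * by (auto intro!: derivative_eq_intros simp: has_vector_derivative_def fun_eq_iff algebra_simps)
qed

lemma continuous_on_cis2: "continuous_on S cis2"
  by (intro continuous_at_imp_continuous_on ballI
      has_vector_derivative_continuous[OF cis2_has_vector_derivative])

text \<open>The quotient rule for \<open>cis2 t\<close> divided by \<open>F (cis2 t)\<close>,
  written out so that continuity in \<open>t\<close> can be read off.\<close>

definition polar' :: "(real^2 \<Rightarrow> real) \<Rightarrow> real \<Rightarrow> real^2" where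
  "polar' F t = (1 / F (cis2 t)) *\<^sub>R vector [- sin t, cos t]
     - (dir F (vector [- sin t, cos t]) (cis2 t) / (F (cis2 t))\<^sup>2) *\<^sub>R cis2 t"

definition speed :: "(real^2 \<Rightarrow> real) \<Rightarrow> real \<Rightarrow> real" where
  "speed F t = sqrt (fund F (polar F t) (polar' F t) (polar' F t))"

context
  fixes F :: "real^2 \<Rightarrow> real"
  assumes F: "minkowski_norm F"
begin

lemma F_cis2_pos: "0 < F (cis2 t)"
  by (rule minkowski_norm_pos[OF F]) simp

lemma polar_nonzero: "polar F t \<noteq> 0"
  using F_cis2_pos[of t] by (simp add: polar_def)

lemma norm_polar: "norm (polar F t) = 1 / F (cis2 t)"
  using F_cis2_pos[of t] by (simp add: polar_def)

lemma F_polar: "F (polar F t) = 1"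
  using minkowski_norm_scale[OF F, of "1 / F (cis2 t)" "cis2 t"] F_cis2_pos[of t]
  by (simp add: polar_def)

lemma polar_has_vector_derivative: "(polar F has_vector_derivative polar' F t) (at t)"
proof -
  note c = cis2_has_vector_derivative[of t]
  have "(F has_derivative (\<lambda>v. dir F v (cis2 t))) (at (cis2 t))"
    by (rule smooth_on_has_derivative[OF minkowski_norm_smooth[OF F]]) simp
  from vector_derivative_diff_chain_within[OF c has_derivative_at_withinI[OF this]]
  have "((\<lambda>t. F (cis2 t)) has_real_derivative dir F (vector [- sin t, cos t]) (cis2 t)) (at t)"
    by (simp add: has_real_derivative_iff_has_vector_derivative o_def)
  then have "((\<lambda>t. 1 / F (cis2 t)) has_real_derivative
      - (dir F (vector [- sin t, cos t]) (cis2 t) / (F (cis2 t))\<^sup>2)) (at t)"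
    using F_cis2_pos[of t] by (auto intro!: derivative_eq_intros simp: power2_eq_square)
  from has_vector_derivative_scaleR[OF this c] show ?thesis
    by (simp add: polar_def[abs_def] polar'_def)
qed

lemma continuous_on_polar: "continuous_on S (polar F)"
  by (intro continuous_at_imp_continuous_on ballI
      has_vector_derivative_continuous[OF polar_has_vector_derivative])

lemma continuous_on_polar': "continuous_on S (polar' F)"
proof -
  note c = continuous_on_cis2[of S]
  have "continuous_on S (\<lambda>t. cis2 (t + pi / 2))"
    by (rule continuous_on_compose2[OF continuous_on_cis2[of UNIV]])
      (intro continuous_on_add continuous_on_id continuous_on_const, simp)
  then have c': "continuous_on S (\<lambda>t. vector [- sin t, cos t] :: real^2)"
    by (simp add: cos_add sin_add)
  have "continuous_on S (\<lambda>t. F (cis2 t))"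
    by (rule continuous_on_compose2[OF smooth_on_continuous[OF minkowski_norm_smooth[OF F]] c]) auto
  moreover have "continuous_on S (\<lambda>t. dir F (vector [- sin t, cos t]) (cis2 t))"
    by (rule continuous_on_dir[OF minkowski_norm_smooth[OF F] c c']) auto
  moreover have "F (cis2 t) \<noteq> 0" for t
    using F_cis2_pos[of t] by simp
  ultimately show ?thesis
    unfolding polar'_def[abs_def] using c c'
    by (intro continuous_on_diff continuous_on_scaleR continuous_on_divide continuous_on_power
        continuous_on_const) auto
qed

lemma continuous_on_speed: "continuous_on S (speed F)"
  unfolding speed_def[abs_def]
  by (intro continuous_on_real_sqrt continuous_on_fund F continuous_on_polar continuous_on_polar'
      polar_nonzero)

lemma polar_periodic: "polar F (t + 2 * pi) = polar F t"
  by (simp add: polar_def)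

lemma speed_periodic: "speed F (t + 2 * pi) = speed F t"
  by (simp add: speed_def polar'_def polar_periodic)

text \<open>\<open>F\<close> is constantly 1 along \<open>polar F\<close>. So
  \<open>polar' F t\<close> lies in the tangent line of the indicatrix, which is where
  \<open>indicatrix_isometry\<close> compares the two metrics.\<close>

lemma dir_polar': "dir F (polar' F t) (polar F t) = 0"
proof -
  have "(F has_derivative (\<lambda>v. dir F v (polar F t))) (at (polar F t))"
    by (rule smooth_on_has_derivative[OF minkowski_norm_smooth[OF F]]) (simp add: polar_nonzero)
  from vector_derivative_diff_chain_within[OF polar_has_vector_derivative
      has_derivative_at_withinI[OF this]]
  have "((\<lambda>_::real. 1) has_vector_derivative dir F (polar' F t) (polar F t)) (at t)"
    by (simp add: o_def F_polar)
  then show ?thesis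
    using vector_derivative_unique_at[OF _ has_vector_derivative_const] by blast
qed

lemma arc_length_eq: "arc_length F A = integral {t \<in> {0..2 * pi}. polar F t \<in> A} (speed F)"
  unfolding arc_length_def speed_def[abs_def]
  by (simp only: vector_derivative_at[OF polar_has_vector_derivative])

end

section \<open>Integrals over a period and over half a period\<close>

lemma has_integral_period:
  fixes f :: "real \<Rightarrow> real"
  assumes per: "\<And>t. f (t + p) = f t" and a: "0 \<le> a" "a \<le> p"
    and f: "(f has_integral I) {a..a + p}"
  shows "(f has_integral I) {0..p}"
proof -
  have "f integrable_on {a..p}" "f integrable_on {p..a + p}"
    using f a by (auto intro: integrable_subinterval_real)
  then obtain J K where J: "(f has_integral J) {a..p}" and K: "(f has_integral K) {p..a + p}"
    by blast
  have "(f has_integral (J + K)) {a..a + p}"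
    by (rule has_integral_combine[OF _ _ J K]) (use a in auto)
  then have "I = J + K"
    using f has_integral_unique by blast
  moreover have "f \<circ> (+) p = f"
    using per by (auto simp: fun_eq_iff add.commute)
  then have "(f has_integral K) {0..a}"
    using K has_integral_shift_Icc_real[of f p K 0 a] by simp
  then have "(f has_integral (K + J)) {0..p}"
    using has_integral_combine[OF _ _ _ J] a by blast
  ultimately show ?thesis by (simp add: add.commute)
qed

text \<open>\<open>n\<close> is \<open>r\<close> times the vector with coordinates
  \<open>- sin a\<close> and \<open>cos a\<close>. Thus \<open>a\<close> is the angle of the
  boundary ray from which the half plane \<open>0 \<le> n \<bullet> v\<close> is swept out
  counterclockwise, up to the angle \<open>a + pi\<close>.\<close>

lemma rotated_polar_form:
  fixes n :: "real^2"
  assumes "n \<noteq> 0"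
  obtains r a where "0 < r" "0 \<le> a" "a \<le> 2 * pi" "\<And>t. n \<bullet> cis2 t = r * sin (t - a)"
proof -
  define r where "r = norm n"
  have r: "0 < r" using assms by (simp add: r_def)
  have rn: "r\<^sup>2 = (n$1)\<^sup>2 + (n$2)\<^sup>2"
    unfolding r_def power2_norm_eq_inner by (simp add: inner_vec2 power2_eq_square)
  have "(n$2 / r)\<^sup>2 + (- n$1 / r)\<^sup>2 = ((n$1)\<^sup>2 + (n$2)\<^sup>2) / r\<^sup>2"
    by (simp add: power_divide add_divide_distrib)
  then have "(n$2 / r)\<^sup>2 + (- n$1 / r)\<^sup>2 = 1"
    unfolding rn[symmetric] using r by simp
  then obtain a where a: "0 \<le> a" "a < 2 * pi" "n$2 / r = cos a" "- n$1 / r = sin a"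
    using sincos_total_2pi by metis
  then have "n$2 = r * cos a" "n$1 = - (r * sin a)"
    using r by (simp_all add: field_simps)
  then have "n \<bullet> cis2 t = r * sin (t - a)" for t
    by (simp add: inner_vec2 sin_diff algebra_simps)
  with r a that show ?thesis by force
qed

text \<open>The sign of \<open>n \<bullet> polar F t\<close> is that of \<open>sin (t - a)\<close>,
  so in the window from \<open>a\<close> to \<open>a + 2 * pi\<close> each half plane is an interval
  up to finitely many points. In the window from 0 to \<open>2 * pi\<close> used by
  \<open>arc_length\<close> it may be cut in two; periodicity moves one window to the other.\<close>

lemma arc_length_half:
  assumes F: "minkowski_norm F" and a: "0 \<le> a" "a \<le> 2 * pi" "0 < r"
    and n: "\<And>t. n \<bullet> cis2 t = r * sin (t - a)"
  shows "arc_length F {v. F v = 1 \<and> 0 \<le> n \<bullet> v} = integral {a..a + pi} (speed F)" (is ?P)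
    and "arc_length F {v. F v = 1 \<and> n \<bullet> v \<le> 0} = integral {a + pi..a + 2 * pi} (speed F)" (is ?Q)
    and "arc_length F {v. F v = 1} = integral {a..a + 2 * pi} (speed F)" (is ?R)
proof -
  have int: "(speed F has_integral integral {b..c} (speed F)) {b..c}" for b c
    using continuous_on_speed[OF F] integrable_continuous_real by blast
  have eq: "n \<bullet> polar F t = (r / F (cis2 t)) * sin (t - a)" for t
    by (simp add: polar_def n)
  have "0 < r / F (cis2 t)" for t
    using F_cis2_pos[OF F] a by simp
  note cancel = mult_le_cancel_left_pos[OF this]
  have sgn: "0 \<le> n \<bullet> polar F t \<longleftrightarrow> 0 \<le> sin (t - a)"
      "n \<bullet> polar F t \<le> 0 \<longleftrightarrow> sin (t - a) \<le> 0" for t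
    using cancel[of t 0 "sin (t - a)"] cancel[of t "sin (t - a)" 0] by (simp_all only: eq mult_zero_right)
  have pos: "0 < sin (t - a)" if "t \<in> {a..a + pi} - {a, a + pi}" for t
    using that by (intro sin_gt_zero) auto
  have neg: "sin (t - a) < 0" if "t \<in> {a + pi..a + 2 * pi} - {a + pi, a + 2 * pi}" for t
    using that by (intro sin_lt_zero) auto
  \<comment> \<open>The change of window for an arbitrary property \<open>A\<close> of vectors. It
    serves the two half planes and, with \<open>A\<close> always true, the full indicatrix.\<close>
  have eq: "arc_length F {v. F v = 1 \<and> A v} = I"
    if per: "\<And>t. A (polar F (t + 2 * pi)) = A (polar F t)"
      and I: "((\<lambda>t. if A (polar F t) then speed F t else 0) has_integral I) {a..a + 2 * pi}" for A I
  proof -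
    have "((\<lambda>t. if A (polar F t) then speed F t else 0) has_integral I) {0..2 * pi}"
      by (rule has_integral_period[OF _ a(1,2) I]) (use per speed_periodic[OF F] in auto)
    then have "((\<lambda>t. if t \<in> {t. A (polar F t)} then speed F t else 0) has_integral I) {0..2 * pi}"
      by simp
    then have "(speed F has_integral I) ({t. A (polar F t)} \<inter> {0..2 * pi})"
      using has_integral_restrict_Int[of "{t. A (polar F t)}" "speed F" I "{0..2 * pi}"] by blast
    moreover have "{t. A (polar F t)} \<inter> {0..2 * pi} =
        {t \<in> {0..2 * pi}. polar F t \<in> {v. F v = 1 \<and> A v}}"
      using F_polar[OF F] by auto
    ultimately show ?thesis
      by (simp add: arc_length_eq[OF F] integral_unique)
  qed
  have per: "polar F (t + 2 * pi) = polar F t" for t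
    by (rule polar_periodic[OF F])
  show ?P
  proof (rule eq)
    let ?f = "\<lambda>t. if 0 \<le> n \<bullet> polar F t then speed F t else 0"
    have "(?f has_integral integral {a..a + pi} (speed F)) {a..a + pi}"
      by (rule has_integral_spike_finite[OF _ _ int[of a "a + pi"], of "{a, a + pi}"])
        (use pos neg in \<open>fastforce simp: sgn\<close>)+
    moreover have "(?f has_integral 0) {a + pi..a + 2 * pi}"
      by (rule has_integral_spike_finite[OF _ _ has_integral_0, of "{a + pi, a + 2 * pi}"])
        (use pos neg in \<open>fastforce simp: sgn\<close>)+
    ultimately show "(?f has_integral integral {a..a + pi} (speed F)) {a..a + 2 * pi}"
      using has_integral_combine[of a "a + pi" "a + 2 * pi" ?f] by fastforce
  qed (simp add: per)
  show ?Q
  proof (rule eq)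
    let ?f = "\<lambda>t. if n \<bullet> polar F t \<le> 0 then speed F t else 0"
    have "(?f has_integral integral {a + pi..a + 2 * pi} (speed F)) {a + pi..a + 2 * pi}"
      by (rule has_integral_spike_finite[OF _ _ int, of "{a + pi, a + 2 * pi}"])
        (use pos neg in \<open>fastforce simp: sgn\<close>)+
    moreover have "(?f has_integral 0) {a..a + pi}"
      by (rule has_integral_spike_finite[OF _ _ has_integral_0, of "{a, a + pi}"])
        (use pos neg in \<open>fastforce simp: sgn\<close>)+
    ultimately show "(?f has_integral integral {a + pi..a + 2 * pi} (speed F)) {a..a + 2 * pi}"
      using has_integral_combine[of a "a + pi" "a + 2 * pi" ?f] by fastforce
  qed (simp add: per)
  show ?R
    using eq[of "\<lambda>_. True"] int by simp
qed

lemma arc_length_split: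
  assumes F: "minkowski_norm F" and n: "n \<noteq> 0"
  shows "arc_length F {v. F v = 1 \<and> 0 \<le> n \<bullet> v} + arc_length F {v. F v = 1 \<and> n \<bullet> v \<le> 0} =
    arc_length F {v. F v = 1}"
proof -
  obtain r a where a: "0 < r" "0 \<le> a" "a \<le> 2 * pi" "\<And>t. n \<bullet> cis2 t = r * sin (t - a)"
    using rotated_polar_form[OF n] by metis
  show ?thesis
    unfolding arc_length_half[OF F a(2,3,1,4)]
    by (rule Henstock_Kurzweil_Integration.integral_combine)
      (auto intro: integrable_continuous_real continuous_on_speed[OF F])
qed

section \<open>Isometries of half indicatrices\<close>

text \<open>An injective continuous function on an interval is strictly monotone. The sign \<sigma>
  records whether it preserves or reverses the orientation, so that both cases can later run through
  one computation.\<close>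

lemma inj_continuous_surj_interval:
  fixes f :: "real \<Rightarrow> real"
  assumes f: "continuous_on {a..b} f" "inj_on f {a..b}" "f ` {a..b} = {c..d}" and ab: "a < b"
  obtains \<sigma> where "\<sigma> = 1 \<and> f a = c \<and> f b = d \<or> \<sigma> = -1 \<and> f a = d \<and> f b = c"
    "mono_on {a..b} (\<lambda>t. \<sigma> * f t)" "f ` {a<..<b} \<subseteq> {c<..<d}"
proof -
  have ends: "c \<in> f ` {a..b}" "d \<in> f ` {a..b}"
    using f(3) ab by (metis atLeastAtMost_iff atLeastatMost_empty_iff2 empty_not_UNIV image_is_empty
        less_le_not_le linorder_linear order_refl)+
  then obtain p q where p: "p \<in> {a..b}" "f p = c" and q: "q \<in> {a..b}" "f q = d"
    by auto
  have le: "c \<le> f t" "f t \<le> d" if "t \<in> {a..b}" for t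
    using f(3) that by auto
  consider "strict_mono_on {a..b} f" | "strict_antimono_on {a..b} f"
    using injective_eq_monotone_map[of "{a..b}" f] f by auto
  then show ?thesis
  proof cases
    case 1
    note m = strict_mono_onD[OF 1]
    have m': "s \<le> t \<Longrightarrow> s \<in> {a..b} \<Longrightarrow> t \<in> {a..b} \<Longrightarrow> f s \<le> f t" for s t
      using m[of s t] by (cases "s = t") auto
    have "f a = c" "f b = d"
      using m'[of a p] m'[of q b] p q le[of a] le[of b] by auto
    moreover have "f ` {a<..<b} \<subseteq> {c<..<d}"
    proof safe
      fix t assume t: "t \<in> {a<..<b}"
      show "f t \<in> {c<..<d}"
        using m[of a t] m[of t b] t \<open>f a = c\<close> \<open>f b = d\<close> by auto
    qed
    moreover have "mono_on {a..b} f"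
      using m' by (intro mono_onI)
    ultimately show ?thesis by (intro that[of 1]) auto
  next
    case 2
    note m = monotone_onD[OF 2]
    have m': "s \<le> t \<Longrightarrow> s \<in> {a..b} \<Longrightarrow> t \<in> {a..b} \<Longrightarrow> f t \<le> f s" for s t
      using m[of s t] by (cases "s = t") auto
    have "f a = d" "f b = c"
      using m'[of a q] m'[of p b] p q le[of a] le[of b] by auto
    moreover have "f ` {a<..<b} \<subseteq> {c<..<d}"
    proof safe
      fix t assume t: "t \<in> {a<..<b}"
      show "f t \<in> {c<..<d}"
        using m[of a t] m[of t b] t \<open>f a = d\<close> \<open>f b = c\<close> by auto
    qed
    moreover have "mono_on {a..b} (\<lambda>t. - f t)"
      using m' by (intro mono_onI) simp
    ultimately show ?thesis by (intro that[of "-1"]) auto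
  qed
qed

text \<open>The inverse of \<open>polar F\<close> on the angles from \<open>a\<close> to
  \<open>a + pi\<close>. A half indicatrix spans exactly the angle \<open>pi\<close>, the range of
  \<open>arccos\<close>; measuring from the ray at angle \<open>a\<close> therefore gives a
  coordinate that is continuous up to both end points and has no branch cut on the arc, whatever
  \<open>a\<close> is.\<close>

definition arc_angle :: "real \<Rightarrow> real^2 \<Rightarrow> real" where
  "arc_angle a v = a + arccos (cis2 a \<bullet> v / norm v)"

context
  fixes F :: "real^2 \<Rightarrow> real" and a :: real
  assumes F: "minkowski_norm F"
begin

lemma cis2_inner_polar: "cis2 a \<bullet> polar F t / norm (polar F t) = cos (t - a)"
  using F_cis2_pos[OF F, of t]
  by (simp add: norm_polar[OF F]) (simp add: polar_def inner_vec2 cos_diff algebra_simps)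

lemma arc_angle_polar: "t \<in> {a..a + pi} \<Longrightarrow> arc_angle a (polar F t) = t"
  unfolding arc_angle_def cis2_inner_polar by (subst arccos_cos) auto

lemma half_indicatrix_eq_arc:
  assumes r: "0 < r" and n: "\<And>t. n \<bullet> cis2 t = r * sin (t - a)"
  shows "{v. F v = 1 \<and> 0 \<le> n \<bullet> v} = polar F ` {a..a + pi}"
proof (intro equalityI subsetI)
  fix v assume v: "v \<in> {v. F v = 1 \<and> 0 \<le> n \<bullet> v}"
  then have v0: "v \<noteq> 0"
    using minkowski_norm_scale[OF F, of 0 0] by auto
  have nv: "(norm v)\<^sup>2 = (v$1)\<^sup>2 + (v$2)\<^sup>2"
    unfolding power2_norm_eq_inner by (simp add: inner_vec2 power2_eq_square)
  have "(v$1 / norm v)\<^sup>2 + (v$2 / norm v)\<^sup>2 = ((v$1)\<^sup>2 + (v$2)\<^sup>2) / (norm v)\<^sup>2"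
    by (simp add: power_divide add_divide_distrib)
  then have "(v$1 / norm v)\<^sup>2 + (v$2 / norm v)\<^sup>2 = 1"
    unfolding nv[symmetric] using v0 by simp
  then obtain s where s: "v$1 / norm v = cos s" "v$2 / norm v = sin s"
    by (rule sincos_total_2pi)
  then have "v$1 = cos s * norm v" "v$2 = sin s * norm v"
    using v0 nonzero_divide_eq_eq[of "norm v"] by (metis norm_eq_zero)+
  then have vs: "v = norm v *\<^sub>R cis2 s"
    by (simp add: vec_eq_iff forall_2)
  have "F v = F (norm v *\<^sub>R cis2 s)"
    using vs by (rule arg_cong)
  also have "\<dots> = norm v * F (cis2 s)"
    by (rule minkowski_norm_scale[OF F norm_ge_zero])
  finally have "norm v * F (cis2 s) = 1"
    using v by simp
  then have norm_v: "norm v = 1 / F (cis2 s)"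
    using F_cis2_pos[OF F, of s] nonzero_eq_divide_eq[of "F (cis2 s)"] by (metis less_irrefl)
  have vp: "v = polar F s"
    using vs unfolding polar_def norm_v .
  have "n \<bullet> v = n \<bullet> (norm v *\<^sub>R cis2 s)"
    using vs by (rule arg_cong)
  also have "\<dots> = norm v * (r * sin (s - a))"
    by (simp only: inner_scaleR_right n)
  finally have sn: "0 \<le> sin (s - a)"
    using v v0 r by (simp add: zero_le_mult_iff)
  \<comment> \<open>The angle \<open>s\<close> found above is determined only modulo
    \<open>2 * pi\<close>. Its representative \<open>t\<close> in the window has the same cosine
    relative to \<open>a\<close> by the choice of \<open>arccos\<close>, and the same sine because
    \<open>sin (s - a)\<close> is nonnegative on the half plane.\<close>
  define t where "t = arc_angle a v"
  have "\<bar>cos (s - a)\<bar> \<le> 1"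
    by simp
  then have "cos (arccos (cos (s - a))) = cos (s - a)"
    by (intro cos_arccos_abs)
  moreover have "sin (arccos (cos (s - a))) = sqrt (1 - (cos (s - a))\<^sup>2)"
    by (intro sin_arccos_abs \<open>\<bar>cos (s - a)\<bar> \<le> 1\<close>)
  then have "sin (arccos (cos (s - a))) = sin (s - a)"
    using sn by (simp only: sin_squared_eq[symmetric] real_sqrt_abs abs_of_nonneg)
  moreover have "arc_angle a v - a = arccos (cos (s - a))"
    by (simp add: arc_angle_def vp cis2_inner_polar)
  ultimately have "cos (t - a) = cos (s - a)" "sin (t - a) = sin (s - a)"
    unfolding t_def by simp_all
  then have "cos (t - a + a) = cos (s - a + a)" "sin (t - a + a) = sin (s - a + a)"
    by (simp_all only: cos_add sin_add)
  then have "v = polar F t"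
    by (simp only: vp polar_def diff_add_cancel)
  moreover have "t \<in> {a..a + pi}"
    using \<open>\<bar>cos (s - a)\<bar> \<le> 1\<close> arccos_bounded[of "cos (s - a)"]
    by (simp add: t_def arc_angle_def vp cis2_inner_polar)
  ultimately show "v \<in> polar F ` {a..a + pi}"
    by blast
next
  fix v assume "v \<in> polar F ` {a..a + pi}"
  then obtain t where t: "t \<in> {a..a + pi}" "v = polar F t"
    by blast
  then have "n \<bullet> v = r / F (cis2 t) * sin (t - a)"
    by (simp add: polar_def n)
  moreover have "0 \<le> sin (t - a)"
    using t by (intro sin_ge_zero) auto
  ultimately show "v \<in> {v. F v = 1 \<and> 0 \<le> n \<bullet> v}"
    using r F_polar[OF F] F_cis2_pos[OF F, of t] t(2) by simp
qed

lemma continuous_on_arc_angle: "continuous_on (polar F ` {a..a + pi}) (arc_angle a)"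
  unfolding arc_angle_def[abs_def]
proof (intro continuous_on_add continuous_on_const continuous_on_arccos continuous_on_divide
    continuous_on_inner continuous_on_norm continuous_on_id)
  show "\<forall>v\<in>polar F ` {a..a + pi}. norm v \<noteq> 0"
    using polar_nonzero[OF F] by auto
  show "\<forall>v\<in>polar F ` {a..a + pi}. - 1 \<le> cis2 a \<bullet> v / norm v \<and> cis2 a \<bullet> v / norm v \<le> 1"
    by (auto simp only: cis2_inner_polar cos_ge_minus_one cos_le_one)
qed

text \<open>The end points are left out because the argument of \<open>arccos\<close> reaches 1 and
  -1 there. For an isometry this costs nothing, as its end points are treated by continuity.\<close>

lemma arc_angle_differentiable:
  assumes t: "t \<in> {a<..<a + pi}"
  shows "arc_angle a differentiable (at (polar F t))"
proof -
  have p: "polar F t \<noteq> 0"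
    by (rule polar_nonzero[OF F])
  have "(\<lambda>v. cis2 a \<bullet> v / norm v) differentiable (at (polar F t))"
    using p by (intro derivative_intros) (auto simp: differentiable_norm_at)
  then obtain D where D: "((\<lambda>v. cis2 a \<bullet> v / norm v) has_derivative D) (at (polar F t))"
    unfolding differentiable_def by blast
  have "cos 0 > cos (t - a)" "cos (t - a) > cos pi"
    using t by (intro cos_monotone_0_pi; auto)+
  then have "DERIV arccos (cis2 a \<bullet> polar F t / norm (polar F t)) :>
      inverse (- sqrt (1 - (cos (t - a))\<^sup>2))"
    unfolding cis2_inner_polar by (intro DERIV_arccos) auto
  from has_derivative_compose[OF D this[unfolded has_field_derivative_def]]
  have "(\<lambda>v. arccos (cis2 a \<bullet> v / norm v)) differentiable (at (polar F t))"
    unfolding differentiable_def by blast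
  then show ?thesis
    unfolding arc_angle_def[abs_def] by (intro differentiable_add differentiable_const)
qed

end

text \<open>Read in the angles of the two arcs, \<open>h\<close> becomes a function \<tau> with
  \<open>\<bar>\<tau>'\<bar> * speed F2 \<tau> = speed F1\<close>. Hence, up to the orientation
  sign, the length function \<open>G\<close> of the second arc composed with \<tau> is an
  antiderivative of the first speed, and its total increment is the length of the second
  arc.\<close>

lemma indicatrix_isometry_arc_length:
  assumes F1: "minkowski_norm F1" and F2: "minkowski_norm F2" and n: "n1 \<noteq> 0" "n2 \<noteq> 0"
    and iso: "indicatrix_isometry F1 {v. F1 v = 1 \<and> 0 \<le> n1 \<bullet> v} F2 {v. F2 v = 1 \<and> 0 \<le> n2 \<bullet> v} h"
  shows "arc_length F1 {v. F1 v = 1 \<and> 0 \<le> n1 \<bullet> v} = arc_length F2 {v. F2 v = 1 \<and> 0 \<le> n2 \<bullet> v}"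
proof -
  obtain r a where a: "0 < r" "0 \<le> a" "a \<le> 2 * pi" "\<And>t. n1 \<bullet> cis2 t = r * sin (t - a)"
    using rotated_polar_form[OF n(1)] by metis
  obtain q c where c: "0 < q" "0 \<le> c" "c \<le> 2 * pi" "\<And>t. n2 \<bullet> cis2 t = q * sin (t - c)"
    using rotated_polar_form[OF n(2)] by metis
  define S1 where "S1 = polar F1 ` {a..a + pi}"
  define S2 where "S2 = polar F2 ` {c..c + pi}"
  note S1_eq = half_indicatrix_eq_arc[OF F1 a(1,4), folded S1_def]
  note S2_eq = half_indicatrix_eq_arc[OF F2 c(1,4), folded S2_def]
  obtain k where k: "homeomorphism S1 S2 h k"
    using iso unfolding indicatrix_isometry_def S1_eq S2_eq by blast
  define \<theta> where "\<theta> = arc_angle c"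
  define \<tau> where "\<tau> t = \<theta> (h (polar F1 t))" for t
  have \<theta>: "\<theta> (polar F2 t) = t" if "t \<in> {c..c + pi}" for t
    unfolding \<theta>_def by (rule arc_angle_polar[OF F2 that])
  have hS: "h (polar F1 t) \<in> S2" if "t \<in> {a..a + pi}" for t
    using k that unfolding homeomorphism_def S1_def by blast
  have \<tau>: "\<tau> t \<in> {c..c + pi}" "polar F2 (\<tau> t) = h (polar F1 t)" if t: "t \<in> {a..a + pi}" for t
    using hS[OF t] \<theta> unfolding \<tau>_def S2_def by auto
  have "h ` S1 = S2" "continuous_on S1 h" "inj_on h S1"
    using k unfolding homeomorphism_def by (auto intro: inj_on_inverseI)
  have inj_polar: "inj_on (polar F1) {a..a + pi}"
    using arc_angle_polar[OF F1, of _ a] by (rule inj_on_inverseI)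
  have "inj_on (\<lambda>t. polar F2 (\<tau> t)) {a..a + pi}"
  proof (rule inj_onI)
    fix s t assume "s \<in> {a..a + pi}" "t \<in> {a..a + pi}" "polar F2 (\<tau> s) = polar F2 (\<tau> t)"
    then show "s = t"
      using \<tau>(2) inj_onD[OF \<open>inj_on h S1\<close>] inj_onD[OF inj_polar] unfolding S1_def
      by (metis imageI)
  qed
  then have \<tau>_inj: "inj_on \<tau> {a..a + pi}"
    by (simp add: inj_on_def)
  have "\<tau> ` {a..a + pi} = \<theta> ` S2"
    using \<open>h ` S1 = S2\<close> unfolding \<tau>_def S1_def by (auto simp: image_image)
  also have "\<dots> = {c..c + pi}"
    unfolding S2_def using \<theta> by (force simp: image_image)
  finally have \<tau>_surj: "\<tau> ` {a..a + pi} = {c..c + pi}" .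
  have \<tau>_cont: "continuous_on {a..a + pi} \<tau>"
  proof -
    have hp: "continuous_on {a..a + pi} (\<lambda>t. h (polar F1 t))"
      by (rule continuous_on_compose2[OF \<open>continuous_on S1 h\<close> continuous_on_polar[OF F1]])
        (simp add: S1_def)
    have "continuous_on S2 \<theta>"
      unfolding \<theta>_def S2_def by (rule continuous_on_arc_angle[OF F2])
    from continuous_on_compose2[OF this hp] show ?thesis
      unfolding \<tau>_def using hS by blast
  qed
  have "a < a + pi"
    by simp
  obtain \<sigma> where \<sigma>: "\<sigma> = 1 \<and> \<tau> a = c \<and> \<tau> (a + pi) = c + pi \<or>
        \<sigma> = -1 \<and> \<tau> a = c + pi \<and> \<tau> (a + pi) = c"
      "mono_on {a..a + pi} (\<lambda>t. \<sigma> * \<tau> t)" "\<tau> ` {a<..<a + pi} \<subseteq> {c<..<c + pi}"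
    by (rule inj_continuous_surj_interval[OF \<tau>_cont \<tau>_inj \<tau>_surj \<open>a < a + pi\<close>])
  define G where "G s = integral {c..s} (speed F2)" for s
  have G: "continuous_on {c..c + pi} G"
    unfolding G_def by (intro indefinite_integral_continuous_1 integrable_continuous_real
        continuous_on_speed[OF F2])
  have G_deriv: "(G has_real_derivative speed F2 s) (at s)" if "s \<in> {c<..<c + pi}" for s
  proof -
    have "(G has_real_derivative speed F2 s) (at s within {c..c + pi})"
      unfolding G_def using that
      by (intro integral_has_real_derivative continuous_on_speed[OF F2]) auto
    then show ?thesis
      using that at_within_interior[of s "{c..c + pi}"] by simp
  qed
  have deriv: "((\<lambda>t. \<sigma> * G (\<tau> t)) has_vector_derivative speed F1 t) (at t)"
    if t: "t \<in> {a<..<a + pi}" for t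
  proof -
    have tI: "t \<in> {a..a + pi}" and at: "at t within {a..a + pi} = at t"
      using t at_within_interior[of t "{a..a + pi}"] by auto
    have \<tau>t: "\<tau> t \<in> {c<..<c + pi}"
      using \<sigma>(3) t by blast
    obtain D where D: "(h has_derivative D) (at (polar F1 t) within S1)"
      and D_iso: "\<And>w. dir F1 w (polar F1 t) = 0 \<Longrightarrow>
        fund F2 (h (polar F1 t)) (D w) (D w) = fund F1 (polar F1 t) w w"
      using iso tI unfolding indicatrix_isometry_def S1_eq S2_eq unfolding S1_def by blast
    \<comment> \<open>The derivative of \<open>h\<close> exists only within the arc, which is the
      image of \<open>{a..a + pi}\<close>; the chain rule relative to images applies, and at an
      interior \<open>t\<close> the result is an ordinary derivative.\<close>
    have "((h \<circ> polar F1) has_vector_derivative D (polar' F1 t)) (at t within {a..a + pi})"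
      by (rule vector_derivative_diff_chain_within[OF has_vector_derivative_at_within[OF
              polar_has_vector_derivative[OF F1]]]) (use D in \<open>simp add: S1_def\<close>)
    then have hp: "((\<lambda>t. h (polar F1 t)) has_vector_derivative D (polar' F1 t)) (at t)"
      by (simp add: at o_def)
    obtain E where "(\<theta> has_derivative E) (at (h (polar F1 t)))"
      using arc_angle_differentiable[OF F2 \<tau>t] \<tau>(2)[OF tI] unfolding \<theta>_def differentiable_def
      by auto
    from vector_derivative_diff_chain_within[OF hp has_derivative_at_withinI[OF this]]
    obtain d where d: "(\<tau> has_real_derivative d) (at t)"
      unfolding \<tau>_def[abs_def] has_real_derivative_iff_has_vector_derivative o_def by blast
    \<comment> \<open>The velocity of the image curve is computed a second time, now as that of
      \<open>polar F2\<close> after \<tau>. Comparison shows that \<open>D\<close> sends the tangent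
      vector \<open>polar' F1 t\<close> to \<open>d\<close> times a tangent vector of the second
      indicatrix, so \<open>D_iso\<close> determines the absolute value of \<open>d\<close>.\<close>
    have "((polar F2 \<circ> \<tau>) has_vector_derivative d *\<^sub>R polar' F2 (\<tau> t)) (at t)"
      using vector_diff_chain_at[OF d[unfolded has_real_derivative_iff_has_vector_derivative]
          polar_has_vector_derivative[OF F2]] .
    then have "((\<lambda>t. h (polar F1 t)) has_vector_derivative d *\<^sub>R polar' F2 (\<tau> t)) (at t)"
      by (rule has_vector_derivative_transform_within_open[of _ _ _ "{a<..<a + pi}"])
        (use t \<tau>(2) in auto)
    with hp have "D (polar' F1 t) = d *\<^sub>R polar' F2 (\<tau> t)"
      by (rule vector_derivative_unique_at)
    with D_iso[OF dir_polar'[OF F1]] have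
      "d\<^sup>2 * fund F2 (polar F2 (\<tau> t)) (polar' F2 (\<tau> t)) (polar' F2 (\<tau> t)) =
        fund F1 (polar F1 t) (polar' F1 t) (polar' F1 t)"
      by (simp add: fund_scale[OF F2 polar_nonzero[OF F2]] flip: \<tau>(2)[OF tI])
    then have sp: "speed F1 t = \<bar>d\<bar> * speed F2 (\<tau> t)"
      unfolding speed_def by (metis real_sqrt_abs real_sqrt_mult)
    \<comment> \<open>Monotonicity of \<sigma> times \<tau> supplies the sign of \<open>d\<close>
      that the quadratic identity loses.\<close>
    have "((\<lambda>t. \<sigma> * \<tau> t) has_real_derivative \<sigma> * d) (at t)"
      using d by (rule DERIV_cmult)
    then have "0 \<le> \<sigma> * d"
      by (rule mono_on_imp_deriv_nonneg[OF \<sigma>(2)]) (use t in simp)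
    then have "\<sigma> * d = \<bar>d\<bar>"
      using \<sigma>(1) by auto
    then have sp': "\<sigma> * (speed F2 (\<tau> t) * d) = speed F1 t"
      by (metis mult.assoc mult.commute sp)
    have "((\<lambda>t. \<sigma> * G (\<tau> t)) has_real_derivative \<sigma> * (speed F2 (\<tau> t) * d)) (at t)"
      by (intro DERIV_cmult DERIV_chain2[OF G_deriv[OF \<tau>t] d])
    then show ?thesis
      unfolding sp' has_real_derivative_iff_has_vector_derivative .
  qed
  have "continuous_on {a..a + pi} (\<lambda>t. \<sigma> * G (\<tau> t))"
    using \<tau>_surj by (intro continuous_on_mult continuous_on_const continuous_on_compose2[OF G \<tau>_cont]) simp
  then have "(speed F1 has_integral \<sigma> * G (\<tau> (a + pi)) - \<sigma> * G (\<tau> a)) {a..a + pi}"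
    by (intro fundamental_theorem_of_calculus_interior deriv) auto
  \<comment> \<open>Since \<open>G c = 0\<close>, both orientations give the same increment.\<close>
  moreover have "\<sigma> * G (\<tau> (a + pi)) - \<sigma> * G (\<tau> a) = G (c + pi)"
    using \<sigma>(1) by (auto simp: G_def)
  ultimately show ?thesis
    unfolding arc_length_half(1)[OF F1 a(2,3,1,4)] arc_length_half(1)[OF F2 c(2,3,1,4)]
    by (simp add: G_def integral_unique)
qed

section \<open>Plane triangles and invariance of domain on surfaces\<close>

text \<open>\<open>m\<close> is the direction of the edge turned by a right angle; the sign of
  \<open>n\<close> is chosen to put the third vertex on the positive side. In the plane the kernel
  of \<open>n\<close> is exactly the line along the edge.\<close>

lemma triangle_normal:
  fixes a b v :: "real^2"
  assumes "\<not> collinear {a, b, v}"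
  obtains n where "n \<bullet> (b - a) = 0" "0 < n \<bullet> (v - a)"
    "\<And>w. n \<bullet> w = 0 \<Longrightarrow> \<exists>\<beta>. w = \<beta> *\<^sub>R (b - a)"
proof -
  define d where "d = b - a"
  define m :: "real^2" where "m = vector [- d$2, d$1]"
  have d: "d \<noteq> 0"
    using assms by (auto simp: d_def)
  have par: "\<exists>\<beta>. w = \<beta> *\<^sub>R d" if "m \<bullet> w = 0" for w
  proof -
    have w: "d$1 * w$2 = d$2 * w$1"
      using that by (simp add: m_def inner_vec2)
    consider "d$1 \<noteq> 0" | "d$2 \<noteq> 0"
      using d by (auto simp: vec_eq_iff forall_2)
    then show ?thesis
    proof cases
      case 1
      then have "w = (w$1 / d$1) *\<^sub>R d"
        using w by (simp add: vec_eq_iff forall_2 field_simps)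
      then show ?thesis ..
    next
      case 2
      then have "w = (w$2 / d$2) *\<^sub>R d"
        using w by (simp add: vec_eq_iff forall_2 field_simps)
      then show ?thesis ..
    qed
  qed
  have "m \<bullet> (v - a) \<noteq> 0"
  proof
    assume "m \<bullet> (v - a) = 0"
    then obtain \<beta> where "v - a = \<beta> *\<^sub>R d"
      using par by blast
    then have "v = (1 - \<beta>) *\<^sub>R a + (1 - (1 - \<beta>)) *\<^sub>R b"
      by (simp add: d_def algebra_simps)
    then have "collinear {a, v, b}"
      unfolding collinear_3_expand by blast
    then show False
      using assms by (simp add: insert_commute)
  qed
  moreover have "m \<bullet> d = 0"
    by (simp add: m_def inner_vec2)
  ultimately consider "m \<bullet> d = 0" "0 < m \<bullet> (v - a)" | "m \<bullet> d = 0" "0 < (- m) \<bullet> (v - a)"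
    by (metis inner_minus_left linorder_neqE_linordered_idom neg_0_less_iff_less)
  then show ?thesis
  proof cases
    case 1
    then show ?thesis
      using that[of m] par by (simp add: d_def)
  next
    case 2
    then show ?thesis
      using that[of "- m"] par by (simp add: d_def)
  qed
qed

text \<open>Measured by \<open>n\<close>, the height of
  \<open>(1 - t) *\<^sub>R p + t *\<^sub>R v\<close> over the edge is \<open>t\<close> times that of
  \<open>v\<close>, wherever \<open>p\<close> lies on the edge. The height thus determines
  \<open>t\<close>, and away from the apex \<open>v\<close> also \<open>p\<close>.\<close>

lemma triangle_cone_unique:
  fixes a b v :: "real^2"
  assumes "\<not> collinear {a, b, v}" and p: "p \<in> convex hull {a, b}" and q: "q \<in> convex hull {a, b}"
    and eq: "(1 - t) *\<^sub>R p + t *\<^sub>R v = (1 - t') *\<^sub>R q + t' *\<^sub>R v" and "t < 1"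
  shows "t = t' \<and> p = q"
proof -
  obtain n where n: "n \<bullet> (b - a) = 0" "0 < n \<bullet> (v - a)"
    using triangle_normal[OF assms(1)] by metis
  have z: "n \<bullet> p = n \<bullet> a" if p: "p \<in> convex hull {a, b}" for p
  proof -
    obtain u w where "p = u *\<^sub>R a + w *\<^sub>R b" "u + w = 1"
      using p unfolding convex_hull_2 by blast
    moreover have "n \<bullet> b = n \<bullet> a"
      using n(1) by (simp add: inner_diff_right)
    then have "n \<bullet> (u *\<^sub>R a + w *\<^sub>R b) = (u + w) * (n \<bullet> a)"
      by (simp add: inner_add_right distrib_right)
    ultimately show ?thesis
      by simp
  qed
  have h: "n \<bullet> ((1 - s) *\<^sub>R p + s *\<^sub>R v) = n \<bullet> a + s * (n \<bullet> (v - a))" if "p \<in> convex hull {a, b}" for p s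
    using z[OF that] by (simp add: inner_add_right inner_diff_right algebra_simps)
  have "t * (n \<bullet> (v - a)) = t' * (n \<bullet> (v - a))"
    using arg_cong[OF eq, of "\<lambda>w. n \<bullet> w"] h[OF p, of t] h[OF q, of t'] by simp
  then have "t = t'"
    using n(2) by simp
  then show ?thesis
    using eq \<open>t < 1\<close> by simp
qed

lemma tangent_cone_interior:
  assumes "p \<in> interior (K :: 'a::real_normed_vector set)"
  shows "{v. \<exists>t>0. p + t *\<^sub>R v \<in> K} = UNIV"
proof -
  have "\<exists>t>0. p + t *\<^sub>R v \<in> K" for v
  proof -
    have "((\<lambda>t. p + t *\<^sub>R v) \<longlongrightarrow> p + 0 *\<^sub>R v) (at_right 0)"
      by (intro tendsto_intros)
    then have "\<forall>\<^sub>F t in at_right 0. p + t *\<^sub>R v \<in> interior K"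
      by (rule topological_tendstoD) (use assms in auto)
    moreover have "\<forall>\<^sub>F t in at_right (0::real). 0 < t"
      by (rule eventually_at_right_less)
    ultimately have "\<forall>\<^sub>F t in at_right (0::real). 0 < t \<and> p + t *\<^sub>R v \<in> K"
      by eventually_elim (use interior_subset in auto)
    then show ?thesis
      using eventually_happens trivial_limit_at_right_real by blast
  qed
  then show ?thesis by blast
qed

text \<open>One inclusion holds because the triangle lies on one side of the line of its edge. For
  the other, a vector of the half plane has a nonnegative component towards \<open>v\<close>, while
  the two remaining barycentric coordinates start at \<open>1 - s\<close> and \<open>s\<close> and
  stay positive for small \<open>t\<close>.\<close>

lemma tangent_cone_edge:
  fixes a b v :: "real^2"
  assumes nc: "\<not> collinear {a, b, v}" and p: "p = (1 - s) *\<^sub>R a + s *\<^sub>R b" and s: "0 < s" "s < 1"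
  obtains n where "n \<noteq> 0" "{w. \<exists>t>0. p + t *\<^sub>R w \<in> convex hull {a, b, v}} = {w. 0 \<le> n \<bullet> w}"
proof -
  obtain n where n: "n \<bullet> (b - a) = 0" "0 < n \<bullet> (v - a)"
    and par: "\<And>w. n \<bullet> w = 0 \<Longrightarrow> \<exists>\<beta>. w = \<beta> *\<^sub>R (b - a)"
    using triangle_normal[OF nc] by blast
  have np: "n \<bullet> p = n \<bullet> a"
    using n(1) by (simp add: p inner_add_right inner_diff_right algebra_simps)
  have "0 \<le> n \<bullet> w" if t: "0 < t" "p + t *\<^sub>R w \<in> convex hull {a, b, v}" for t w
  proof -
    have "convex hull {a, b, v} \<subseteq> {z. n \<bullet> a \<le> n \<bullet> z}"
      using n by (intro hull_minimal convex_halfspace_ge) (auto simp: inner_diff_right)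
    then have "n \<bullet> a \<le> n \<bullet> (p + t *\<^sub>R w)"
      using t(2) by blast
    then show ?thesis
      using t(1) np by (simp add: inner_add_right zero_le_mult_iff)
  qed
  moreover have "\<exists>t>0. p + t *\<^sub>R w \<in> convex hull {a, b, v}" if w: "0 \<le> n \<bullet> w" for w
  proof -
    define \<gamma> where "\<gamma> = n \<bullet> w / (n \<bullet> (v - a))"
    have \<gamma>: "0 \<le> \<gamma>"
      using w n(2) by (simp add: \<gamma>_def)
    have "n \<bullet> (w - \<gamma> *\<^sub>R (v - a)) = 0"
      using n(2) by (simp only: inner_diff_right[of n w] inner_scaleR_right) (simp add: \<gamma>_def)
    then obtain \<beta> where \<beta>: "w = \<gamma> *\<^sub>R (v - a) + \<beta> *\<^sub>R (b - a)"
      using par by (metis add.commute diff_add_cancel)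
    have ev: "\<forall>\<^sub>F t in at_right 0. 0 < f t" if "f 0 > 0" "continuous_on UNIV f" for f :: "real \<Rightarrow> real"
    proof -
      have "(f \<longlongrightarrow> f 0) (at_right 0)"
        using that(2) by (auto simp: continuous_on_def intro: tendsto_within_subset)
      then show ?thesis
        using that(1) by (rule order_tendstoD(1))
    qed
    have "\<forall>\<^sub>F t in at_right 0. 0 < 1 - s - t * \<gamma> - t * \<beta>" "\<forall>\<^sub>F t in at_right 0. 0 < s + t * \<beta>"
      using s by (intro ev; auto intro!: continuous_intros)+
    moreover have "\<forall>\<^sub>F t in at_right (0::real). 0 < t"
      by (rule eventually_at_right_less)
    ultimately have "\<forall>\<^sub>F t in at_right 0. 0 < t \<and> 0 < 1 - s - t * \<gamma> - t * \<beta> \<and> 0 < s + t * \<beta>"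
      by eventually_elim auto
    then obtain t where t: "0 < t" "0 < 1 - s - t * \<gamma> - t * \<beta>" "0 < s + t * \<beta>"
      using eventually_happens trivial_limit_at_right_real by blast
    have "p + t *\<^sub>R w = (1 - s - t * \<gamma> - t * \<beta>) *\<^sub>R a + (s + t * \<beta>) *\<^sub>R b + (t * \<gamma>) *\<^sub>R v"
      by (simp add: p \<beta> algebra_simps)
    moreover have "0 \<le> t * \<gamma>"
      using t(1) \<gamma> by simp
    moreover have "(1 - s - t * \<gamma> - t * \<beta>) + (s + t * \<beta>) + t * \<gamma> = 1"
      by simp
    ultimately have "p + t *\<^sub>R w \<in> convex hull {a, b, v}"
      unfolding convex_hull_3 using t less_imp_le by blast
    then show ?thesis
      using t(1) by blast
  qed
  moreover have "n \<noteq> 0"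
    using n(2) by auto
  ultimately show ?thesis
    using that by blast
qed

section \<open>Interior and edges of a plane simplex\<close>

lemma interior_2_simplex:
  fixes K :: "(real^2) set"
  assumes "2 simplex K"
  shows "interior K \<noteq> {}"
proof -
  have "affine hull K = UNIV"
    using aff_dim_simplex[OF assms] aff_dim_eq_full[of K] by simp
  then have "rel_interior K = interior K"
    by (rule rel_interior_interior)
  moreover have "K \<noteq> {}"
    using aff_dim_simplex[OF assms] by auto
  ultimately show ?thesis
    using rel_interior_eq_empty[OF convex_simplex[OF assms]] by simp
qed

lemma edge_of_2_simplex:
  fixes K :: "(real^2) set"
  assumes "2 simplex K" "e edge_of K"
  obtains a b v where "\<not> collinear {a, b, v}" "K = convex hull {a, b, v}" "e = convex hull {a, b}"
    "a extreme_point_of K" "b extreme_point_of K"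
proof -
  obtain C where C: "\<not> affine_dependent C" "int (card C) = 2 + 1" "K = convex hull C"
    using assms(1) unfolding simplex_def by blast
  then have card: "finite C" "card C = 3"
    using aff_independent_finite by auto
  obtain D where D: "D \<subseteq> C" "e = convex hull D"
    using assms(2) face_of_convex_hull_affine_independent[OF C(1)] C(3) unfolding edge_of_def by blast
  have indD: "\<not> affine_dependent D"
    using C(1) D(1) affine_independent_subset by blast
  have "card D = 2"
    using assms(2) D(2) aff_dim_affine_independent[OF indD]
    by (simp add: edge_of_def aff_dim_convex_hull)
  then obtain a b where ab: "D = {a, b}" "a \<noteq> b"
    by (auto simp: card_2_iff)
  have "card (C - D) = 1"
    using card D(1) \<open>card D = 2\<close> by (simp add: card_Diff_subset finite_subset)
  then obtain v where v: "C - D = {v}"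
    by (auto simp: card_1_singleton_iff)
  then have C': "C = {a, b, v}" and "v \<noteq> a" "v \<noteq> b"
    using D(1) ab(1) by auto
  then have "\<not> collinear {a, b, v}"
    using C(1) ab(2) by (simp add: collinear_3_eq_affine_dependent)
  moreover have "a extreme_point_of K" "b extreme_point_of K"
    using C C' extreme_point_of_convex_hull_affine_independent[OF C(1)] by auto
  ultimately show ?thesis
    using that C(3) C' D(2) ab(1) by blast
qed

text \<open>Near each point of the image, following \<open>G\<close> by a local chart of the surface
  reduces the claim to invariance of domain for maps into the plane. The source is a general
  Euclidean space because the parametrization used later lives on pairs of reals.\<close>

lemma surface_invariance_of_domain:
  fixes G :: "'b::euclidean_space \<Rightarrow> 'a"
  assumes X: "topological_surface X" and W: "open W" and G: "continuous_map (top_of_set W) X G"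
    and inj: "inj_on G W" and dim: "2 \<le> DIM('b)"
  shows "openin X (G ` W)"
proof (subst openin_subopen, rule ballI)
  fix y assume y: "y \<in> G ` W"
  have "G ` W \<subseteq> topspace X"
    using continuous_map_image_subset_topspace[OF G] by simp
  then obtain U V where U: "openin X U" "y \<in> U" and V: "open (V :: (real^2) set)"
    and hom: "subtopology X U homeomorphic_space top_of_set V"
    using X y unfolding topological_surface_def by blast
  then obtain \<psi> where \<psi>: "homeomorphic_map (subtopology X U) (top_of_set V) \<psi>"
    using homeomorphic_space by blast
  have top: "topspace (subtopology X U) = U"
    using openin_subset[OF U(1)] by auto
  define W' where "W' = {w \<in> W. G w \<in> U}"
  have "openin (top_of_set W) W'"
    using openin_continuous_map_preimage[OF G U(1)] by (simp add: W'_def)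
  then have W': "open W'"
    using W openin_open_eq by blast
  have GW': "continuous_map (top_of_set W') (subtopology X U) G"
    using continuous_map_from_subtopology_mono[OF G, of W']
    by (auto simp: W'_def continuous_map_in_subtopology)
  have "continuous_map (top_of_set W') euclidean (\<psi> \<circ> G)"
    using continuous_map_compose[OF GW' homeomorphic_imp_continuous_map[OF \<psi>]]
      continuous_map_into_fulltopology by blast
  then have "continuous_on W' (\<psi> \<circ> G)"
    by simp
  moreover have "inj_on (\<psi> \<circ> G) W'"
    using inj homeomorphic_imp_injective_map[OF \<psi>] top
    by (intro comp_inj_on) (auto simp: W'_def inj_on_def)
  ultimately have "open ((\<psi> \<circ> G) ` W')"
    using W' dim by (intro invariance_of_domain_gen) auto
  moreover have sub: "G ` W' \<subseteq> U"
    by (auto simp: W'_def)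
  ultimately have "openin (top_of_set V) (\<psi> ` (G ` W'))"
    using V homeomorphic_imp_surjective_map[OF \<psi>] top
    by (auto simp: openin_open_eq image_comp)
  then have "openin (subtopology X U) (G ` W')"
    by (simp only: homeomorphic_map_openness_eq[OF \<psi>] top sub simp_thms)
  then have "openin X (G ` W')"
    using U(1) openin_trans_full by blast
  moreover have "y \<in> G ` W'" "G ` W' \<subseteq> G ` W"
    using y U(2) by (auto simp: W'_def)
  ultimately show "\<exists>T. openin X T \<and> y \<in> T \<and> T \<subseteq> G ` W"
    by blast
qed

text \<open>The reverse direction, from surface to plane: precomposing \<open>f\<close> with the
  inverse of a local chart gives an injective map between plane sets. It will show that a point
  having a neighbourhood inside one triangle is interior to that triangle.\<close>

lemma surface_open_image:
  fixes f :: "'a \<Rightarrow> real^2"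
  assumes X: "topological_surface X" and N: "openin X N"
    and f: "continuous_map (subtopology X N) euclidean f" and inj: "inj_on f N"
  shows "open (f ` N)"
proof (subst open_subopen, rule ballI)
  fix z assume "z \<in> f ` N"
  then obtain y where y: "y \<in> N" "z = f y"
    by blast
  then have "y \<in> topspace X"
    using N openin_subset by blast
  then obtain U V where U: "openin X U" "y \<in> U" and V: "open (V :: (real^2) set)"
    and hom: "subtopology X U homeomorphic_space top_of_set V"
    using X unfolding topological_surface_def by blast
  then obtain \<psi> \<phi> where m: "homeomorphic_maps (subtopology X U) (top_of_set V) \<psi> \<phi>"
    unfolding homeomorphic_space_def by blast
  then have \<psi>: "homeomorphic_map (subtopology X U) (top_of_set V) \<psi>"
    and \<phi>: "continuous_map (top_of_set V) (subtopology X U) \<phi>"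
    by (simp_all only: homeomorphic_maps_map, simp_all add: homeomorphic_imp_continuous_map)
  have top: "topspace (subtopology X U) = U"
    using openin_subset[OF U(1)] by auto
  have \<phi>\<psi>: "\<phi> (\<psi> x) = x" if "x \<in> U" for x
    using m that top unfolding homeomorphic_maps_def by blast
  define P where "P = \<psi> ` (N \<inter> U)"
  have "openin (subtopology X U) (N \<inter> U)"
    using N openin_subtopology_Int by blast
  then have "openin (top_of_set V) P"
    unfolding P_def by (simp only: homeomorphic_map_openness_eq[OF \<psi>])
  then have P: "open P" "P \<subseteq> V"
    using V by (auto simp: openin_open_eq)
  have \<phi>P: "\<phi> ` P = N \<inter> U"
    unfolding P_def image_image by (simp add: \<phi>\<psi>)
  have "continuous_map (top_of_set P) (subtopology X U) \<phi>"
    using continuous_map_from_subtopology_mono[OF \<phi> P(2)] .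
  then have "continuous_map (top_of_set P) (subtopology X N) \<phi>"
    using \<phi>P by (auto simp: continuous_map_in_subtopology)
  from continuous_map_compose[OF this f] have "continuous_on P (f \<circ> \<phi>)"
    by simp
  moreover have "inj_on \<phi> P"
    unfolding P_def by (rule inj_onI) (auto simp: \<phi>\<psi>)
  then have "inj_on (f \<circ> \<phi>) P"
    by (rule comp_inj_on) (use inj \<phi>P inj_on_subset in blast)
  ultimately have "open ((f \<circ> \<phi>) ` P)"
    using P(1) by (intro invariance_of_domain_gen) auto
  then have "open (f ` (N \<inter> U))"
    unfolding image_comp[symmetric] \<phi>P .
  then show "\<exists>T. open T \<and> z \<in> T \<and> T \<subseteq> f ` N"
    using y U(2) by blast
qed

text \<open>The neighbourhood is the image of a round disc under the inverse of a local chart, and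
  in dimension two a disc without its centre is connected.\<close>

lemma surface_punctured_nbhd:
  assumes X: "topological_surface X" and Q: "openin X Q" "v \<in> Q"
  obtains D where "openin X D" "v \<in> D" "D \<subseteq> Q" "connectedin X (D - {v})"
proof -
  have "v \<in> topspace X"
    using Q openin_subset by blast
  then obtain U V where U: "openin X U" "v \<in> U" and V: "open (V :: (real^2) set)"
    and hom: "subtopology X U homeomorphic_space top_of_set V"
    using X unfolding topological_surface_def by blast
  then obtain \<psi> \<phi> where m: "homeomorphic_maps (subtopology X U) (top_of_set V) \<psi> \<phi>"
    unfolding homeomorphic_space_def by blast
  then have \<psi>: "homeomorphic_map (subtopology X U) (top_of_set V) \<psi>"
    and \<phi>: "homeomorphic_map (top_of_set V) (subtopology X U) \<phi>"
    by (simp_all only: homeomorphic_maps_map)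
  have top: "topspace (subtopology X U) = U"
    using openin_subset[OF U(1)] by auto
  have \<phi>\<psi>: "\<phi> (\<psi> x) = x" if "x \<in> U" for x
    using m that top unfolding homeomorphic_maps_def by blast
  have \<psi>\<phi>: "\<psi> (\<phi> y) = y" if "y \<in> V" for y
    using m that unfolding homeomorphic_maps_def by simp
  have "openin (subtopology X U) (Q \<inter> U)"
    using Q(1) by (rule openin_subtopology_Int)
  then have "openin (top_of_set V) (\<psi> ` (Q \<inter> U))"
    by (simp only: homeomorphic_map_openness_eq[OF \<psi>])
  then have P: "open (\<psi> ` (Q \<inter> U))" "\<psi> ` (Q \<inter> U) \<subseteq> V"
    using V by (simp_all add: openin_open_eq)
  have "\<psi> v \<in> \<psi> ` (Q \<inter> U)"
    using Q(2) U(2) by blast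
  then obtain r where r: "0 < r" "ball (\<psi> v) r \<subseteq> \<psi> ` (Q \<inter> U)"
    using P(1) open_contains_ball by blast
  let ?B = "ball (\<psi> v) r"
  have BV: "?B \<subseteq> V"
    using r(2) P(2) by (rule order_trans)
  have "openin (top_of_set V) ?B"
    using V BV by (simp add: openin_open_eq)
  then have "openin (subtopology X U) (\<phi> ` ?B)"
    by (simp only: homeomorphic_map_openness_eq[OF \<phi>])
  then have "openin X (\<phi> ` ?B)"
    using U(1) openin_trans_full by blast
  moreover have "v \<in> \<phi> ` ?B"
    using \<phi>\<psi>[OF U(2)] r(1) by (metis centre_in_ball imageI)
  moreover have "\<phi> ` ?B \<subseteq> \<phi> ` \<psi> ` (Q \<inter> U)"
    using r(2) by (rule image_mono)
  then have "\<phi> ` ?B \<subseteq> Q"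
    using \<phi>\<psi> by auto
  moreover have "connectedin X (\<phi> ` ?B - {v})"
  proof -
    have "\<phi> ` (?B - {\<psi> v}) = \<phi> ` ?B - {v}"
    proof (intro equalityI subsetI)
      fix x assume "x \<in> \<phi> ` (?B - {\<psi> v})"
      then obtain y where y: "y \<in> ?B" "y \<noteq> \<psi> v" "x = \<phi> y"
        by blast
      then have "\<psi> x = y"
        using \<psi>\<phi> BV by blast
      then show "x \<in> \<phi> ` ?B - {v}"
        using y by blast
    next
      fix x assume "x \<in> \<phi> ` ?B - {v}"
      then obtain y where y: "y \<in> ?B" "x = \<phi> y" "x \<noteq> v"
        by blast
      then have "y \<noteq> \<psi> v"
        using \<phi>\<psi>[OF U(2)] by blast
      then show "x \<in> \<phi> ` (?B - {\<psi> v})"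
        using y by blast
    qed
    moreover have "connected (?B - {\<psi> v})"
      by (rule connected_punctured_ball) simp
    then have "connectedin (top_of_set V) (?B - {\<psi> v})"
      using BV by (auto simp: connectedin_subtopology)
    then have "connectedin (subtopology X U) (\<phi> ` (?B - {\<psi> v}))"
      by (rule connectedin_continuous_map_image[OF homeomorphic_imp_continuous_map[OF \<phi>]])
    ultimately show ?thesis
      by (simp add: connectedin_subtopology)
  qed
  ultimately show ?thesis
    by (rule that)
qed

section \<open>Stars of points\<close>

lemma tcone_interior:
  "chart M T x \<in> interior (chart M T ` T) \<Longrightarrow> tcone M x T = UNIV"
  unfolding tcone_def by (rule tangent_cone_interior)

context
  fixes M :: "'a pf_surface"
  assumes M: "pf_finsler_surface M"
begin

lemma topological_surface_topo: "topological_surface (topo M)"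
  using M unfolding pf_finsler_surface_def by (elim conjE)

lemma Union_triangles: "\<Union> (triangles M) = topspace (topo M)"
  using M unfolding pf_finsler_surface_def by (elim conjE)

lemma locally_finite_triangles: "locally_finite_in (topo M) (triangles M)"
  using M unfolding pf_finsler_surface_def by (elim conjE)

lemma triangle_subset: "T \<in> triangles M \<Longrightarrow> T \<subseteq> topspace (topo M)"
  using Union_triangles by blast

lemma
  assumes "T \<in> triangles M"
  shows minkowski_norm_triangle: "minkowski_norm (fnorm M T)"
    and simplex_chart: "2 simplex (chart M T ` T)"
    and homeomorphic_chart: "homeomorphic_map (subtopology (topo M) T)
      (top_of_set (chart M T ` T)) (chart M T)"
proof -
  have "\<forall>T\<in>triangles M. minkowski_norm (fnorm M T) \<and> 2 simplex (chart M T ` T) \<and>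
      homeomorphic_map (subtopology (topo M) T) (top_of_set (chart M T ` T)) (chart M T)"
    using M unfolding pf_finsler_surface_def by (elim conjE)
  from bspec[OF this assms] show "minkowski_norm (fnorm M T)" "2 simplex (chart M T ` T)"
    "homeomorphic_map (subtopology (topo M) T) (top_of_set (chart M T ` T)) (chart M T)"
    by simp_all
qed

lemma triangles_meet:
  assumes "T \<in> triangles M" "T' \<in> triangles M" "T \<noteq> T'" "x \<in> T" "x \<in> T'"
  shows "share_edge M T T' \<or> share_vertex M T T'"
proof -
  have "\<forall>T\<in>triangles M. \<forall>T'\<in>triangles M. T \<noteq> T' \<longrightarrow>
      T \<inter> T' = {} \<or> share_edge M T T' \<or> share_vertex M T T'"
    using M unfolding pf_finsler_surface_def by (elim conjE)
  then show ?thesis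
    using assms by blast
qed

lemma topspace_triangle: "T \<in> triangles M \<Longrightarrow> topspace (subtopology (topo M) T) = T"
  using triangle_subset by auto

lemma inj_on_chart: "T \<in> triangles M \<Longrightarrow> inj_on (chart M T) T"
  using homeomorphic_imp_injective_map[OF homeomorphic_chart] topspace_triangle by simp

lemma obtain_chart_inverse:
  assumes "T \<in> triangles M"
  obtains d where "continuous_map (top_of_set (chart M T ` T)) (topo M) d"
    "\<forall>y\<in>T. d (chart M T y) = y"
proof -
  obtain d where d: "homeomorphic_maps (subtopology (topo M) T) (top_of_set (chart M T ` T)) (chart M T) d"
    using homeomorphic_chart[OF assms] homeomorphic_map_maps by blast
  show ?thesis
  proof
    show "continuous_map (top_of_set (chart M T ` T)) (topo M) d"
      using d unfolding homeomorphic_maps_def by (blast intro: continuous_map_into_fulltopology)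
    show "\<forall>y\<in>T. d (chart M T y) = y"
      using d topspace_triangle[OF assms] unfolding homeomorphic_maps_def by blast
  qed
qed

section \<open>Triangles in a neighbourhood of a point\<close>

lemma closedin_triangle:
  assumes T: "T \<in> triangles M"
  shows "closedin (topo M) T"
proof -
  have "compact (chart M T ` T)"
    by (rule compact_simplex[OF simplex_chart[OF T]])
  then have "compact_space (top_of_set (chart M T ` T))"
    by (simp add: compact_space_subtopology)
  then have "compact_space (subtopology (topo M) T)"
    using homeomorphic_compact_space homeomorphic_map_imp_homeomorphic_space[OF homeomorphic_chart[OF T]]
    by blast
  then have "compactin (topo M) T"
    using compactin_subspace triangle_subset[OF T] by blast
  then show ?thesis
    using compactin_imp_closedin topological_surface_topo unfolding topological_surface_def by blast
qed

lemma closedin_Union_triangles: "\<A> \<subseteq> triangles M \<Longrightarrow> closedin (topo M) (\<Union> \<A>)"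
  by (meson closedin_locally_finite_Union closedin_triangle locally_finite_in_subset
      locally_finite_triangles subsetD)

lemma nbhd_subset_star:
  assumes x: "x \<in> topspace (topo M)"
  obtains N where "openin (topo M) N" "x \<in> N" "N \<subseteq> \<Union> (star M x)"
proof
  let ?A = "{T \<in> triangles M. x \<notin> T}"
  have "closedin (topo M) (\<Union> ?A)"
    by (rule closedin_Union_triangles) blast
  then show "openin (topo M) (topspace (topo M) - \<Union> ?A)"
    by blast
  show "x \<in> topspace (topo M) - \<Union> ?A"
    using x by blast
  show "topspace (topo M) - \<Union> ?A \<subseteq> \<Union> (star M x)"
    using Union_triangles by (auto simp: star_def)
qed

text \<open>A common edge or vertex is a face of smaller dimension, and a proper face misses the
  interior. Equivalently, a point interior to a triangle lies in no other triangle.\<close>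

lemma common_point_not_interior:
  assumes T: "T \<in> triangles M" "T' \<in> triangles M" "T \<noteq> T'" and y: "y \<in> T" "y \<in> T'"
  shows "chart M T y \<notin> interior (chart M T ` T)"
proof -
  have dim: "aff_dim (chart M T ` T) = 2"
    using aff_dim_simplex[OF simplex_chart[OF T(1)]] by simp
  consider "share_edge M T T'" | "share_vertex M T T'"
    using triangles_meet[OF T y] by blast
  then show ?thesis
  proof cases
    case 1
    then have e: "chart M T ` (T \<inter> T') face_of chart M T ` T" "aff_dim (chart M T ` (T \<inter> T')) = 1"
      unfolding share_edge_def is_edge_of_def edge_of_def by blast+
    then have "chart M T ` (T \<inter> T') \<noteq> chart M T ` T"
      using dim by force
    from face_of_disjoint_interior[OF e(1) this] show ?thesis
      using y by blast
  next
    case 2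
    then obtain z where "T \<inter> T' = {z}" "vertex_of M T z"
      unfolding share_vertex_def by blast
    with y have "vertex_of M T y"
      by (metis IntI singletonD)
    then have e: "{chart M T y} face_of chart M T ` T"
      unfolding vertex_of_def by (simp only: face_of_singleton)
    have "{chart M T y} \<noteq> chart M T ` T"
      using dim aff_dim_sing[of "chart M T y"] by force
    from face_of_disjoint_interior[OF e this] show ?thesis
      by blast
  qed
qed

text \<open>A convex set with nonempty interior lies in the closure of that interior. Since interior
  points belong to a single triangle, this detects every triangle at \<open>x\<close> inside any
  given neighbourhood.\<close>

lemma interior_point_near:
  assumes T: "T \<in> triangles M" "x \<in> T" and N: "openin (topo M) N" "x \<in> N"
  obtains y where "y \<in> N" "y \<in> T" "chart M T y \<in> interior (chart M T ` T)"
proof -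
  let ?K = "chart M T ` T"
  have "openin (subtopology (topo M) T) (N \<inter> T)"
    using N(1) by (rule openin_subtopology_Int)
  then have "openin (top_of_set ?K) (chart M T ` (N \<inter> T))"
    by (simp only: homeomorphic_map_openness_eq[OF homeomorphic_chart[OF T(1)]])
  then obtain V where V: "open V" "chart M T ` (N \<inter> T) = ?K \<inter> V"
    by (auto simp: openin_open)
  have cl: "closure (interior ?K) = closure ?K"
    using simplex_chart[OF T(1)] by (intro convex_closure_interior convex_simplex interior_2_simplex)
  have "chart M T x \<in> closure (interior ?K)" "chart M T x \<in> V"
    using V(2) T(2) N(2) closure_subset[of ?K] unfolding cl by auto
  then have "V \<inter> interior ?K \<noteq> {}"
    using open_Int_closure_eq_empty[OF V(1), of "interior ?K"] by blast
  then obtain z where z: "z \<in> V" "z \<in> interior ?K"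
    by blast
  then have "z \<in> chart M T ` (N \<inter> T)"
    using V(2) interior_subset by blast
  then obtain y where "y \<in> N" "y \<in> T" "z = chart M T y"
    by blast
  with z(2) show ?thesis
    by (intro that) simp_all
qed

lemma edge_coordinates:
  assumes T: "T \<in> triangles M" and E: "is_edge_of M T E"
  obtains a b v where "\<not> collinear {a, b, v}" "chart M T ` T = convex hull {a, b, v}"
    "chart M T ` E = convex hull {a, b}"
    "\<forall>x\<in>E. \<not> vertex_of M T x \<longrightarrow>
      (\<exists>s. 0 < s \<and> s < 1 \<and> chart M T x = (1 - s) *\<^sub>R a + s *\<^sub>R b)"
proof -
  have E': "E \<subseteq> T" "chart M T ` E edge_of chart M T ` T"
    using E unfolding is_edge_of_def by blast+
  obtain a b v where abv: "\<not> collinear {a, b, v}" "chart M T ` T = convex hull {a, b, v}"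
    "chart M T ` E = convex hull {a, b}"
    "a extreme_point_of (chart M T ` T)" "b extreme_point_of (chart M T ` T)"
    by (rule edge_of_2_simplex[OF simplex_chart[OF T] E'(2)])
  have "\<exists>s. 0 < s \<and> s < 1 \<and> chart M T x = (1 - s) *\<^sub>R a + s *\<^sub>R b"
    if x: "x \<in> E" "\<not> vertex_of M T x" for x
  proof -
    have "chart M T x \<in> closed_segment a b"
      using x(1) abv(3) by (auto simp: segment_convex_hull)
    moreover have "chart M T x \<noteq> a" "chart M T x \<noteq> b"
      using x E'(1) abv(4,5) unfolding vertex_of_def by blast+
    ultimately have "chart M T x \<in> open_segment a b"
      by (simp add: open_segment_def)
    then show ?thesis
      unfolding in_segment by blast
  qed
  then show ?thesis
    using abv(1-3) by (intro that ballI impI)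
qed

lemma tcone_edge:
  assumes "T \<in> triangles M" "is_edge_of M T E" "x \<in> E" "\<not> vertex_of M T x"
  obtains n where "n \<noteq> 0" "tcone M x T = {v. 0 \<le> n \<bullet> v}"
proof -
  obtain a b v where abv: "\<not> collinear {a, b, v}" "chart M T ` T = convex hull {a, b, v}"
    "chart M T ` E = convex hull {a, b}"
    "\<forall>x\<in>E. \<not> vertex_of M T x \<longrightarrow>
      (\<exists>s. 0 < s \<and> s < 1 \<and> chart M T x = (1 - s) *\<^sub>R a + s *\<^sub>R b)"
    by (rule edge_coordinates[OF assms(1,2)])
  obtain s where s: "0 < s" "s < 1" "chart M T x = (1 - s) *\<^sub>R a + s *\<^sub>R b"
    using abv(4) assms(3,4) by blast
  show ?thesis
    by (rule tangent_cone_edge[OF abv(1) s(3,1,2)]) (rule that, simp_all add: tcone_def abv(2))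
qed

text \<open>A neighbourhood of an interior point \<open>x\<close> of a common edge is swept out by the segments that
  join the points of the edge to the opposite vertices of the two triangles.\<close>

lemma share_edge_nbhd:
  assumes T: "T1 \<in> triangles M" "T2 \<in> triangles M" "share_edge M T1 T2"
    and x: "x \<in> T1 \<inter> T2" "\<not> vertex_of M T1 x"
  obtains N where "openin (topo M) N" "x \<in> N" "N \<subseteq> T1 \<union> T2"
proof -
  let ?c1 = "chart M T1" and ?c2 = "chart M T2"
  have E: "is_edge_of M T1 (T1 \<inter> T2)" "is_edge_of M T2 (T1 \<inter> T2)"
    using T(3) unfolding share_edge_def by blast+
  obtain a b v where abv: "\<not> collinear {a, b, v}" "?c1 ` T1 = convex hull {a, b, v}"
    "?c1 ` (T1 \<inter> T2) = convex hull {a, b}"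
    "\<forall>x\<in>T1 \<inter> T2. \<not> vertex_of M T1 x \<longrightarrow>
      (\<exists>s. 0 < s \<and> s < 1 \<and> ?c1 x = (1 - s) *\<^sub>R a + s *\<^sub>R b)"
    by (rule edge_coordinates[OF T(1) E(1)])
  obtain a' b' w where abw: "\<not> collinear {a', b', w}" "?c2 ` T2 = convex hull {a', b', w}"
    "?c2 ` (T1 \<inter> T2) = convex hull {a', b'}"
    by (rule edge_coordinates[OF T(2) E(2)])
  obtain s0 where s0: "0 < s0" "s0 < 1" "?c1 x = (1 - s0) *\<^sub>R a + s0 *\<^sub>R b"
    using abv(4) x by blast
  obtain d1 where d1: "continuous_map (top_of_set (?c1 ` T1)) (topo M) d1" "\<forall>y\<in>T1. d1 (?c1 y) = y"
    by (rule obtain_chart_inverse[OF T(1)])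
  obtain d2 where d2: "continuous_map (top_of_set (?c2 ` T2)) (topo M) d2" "\<forall>y\<in>T2. d2 (?c2 y) = y"
    by (rule obtain_chart_inverse[OF T(2)])
  \<comment> \<open>The first coordinate is the position along the open edge, the second a signed
    height over it: nonnegative into \<open>T1\<close> towards \<open>v\<close>, negative into
    \<open>T2\<close> towards \<open>w\<close>. Heights 1 and -1, where all segments reach the same
    apex, are left out to keep the map injective.\<close>
  define W where "W = {0<..<1::real} \<times> {- 1<..<1::real}"
  define e where "e s = (1 - s) *\<^sub>R a + s *\<^sub>R b" for s :: real
  \<comment> \<open>The same edge point in the chart of \<open>T2\<close>, transported through the
    surface itself; no matching of \<open>a'\<close> and \<open>b'\<close> with \<open>a\<close> and
    \<open>b\<close> has to be fixed.\<close>
  define f where "f s = ?c2 (d1 (e s))" for s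
  define p where "p z = (1 - snd z) *\<^sub>R e (fst z) + snd z *\<^sub>R v" for z :: "real \<times> real"
  define q where "q z = (1 - (- snd z)) *\<^sub>R f (fst z) + (- snd z) *\<^sub>R w" for z :: "real \<times> real"
  define G where "G z = (if 0 \<le> snd z then d1 (p z) else d2 (q z))" for z
  have cone: "(1 - t) *\<^sub>R p + t *\<^sub>R v \<in> convex hull {a, b, v}"
    if "p \<in> convex hull {a, b}" "0 \<le> t" "t \<le> 1" for p t and a b v :: "real^2"
    by (rule convexD_alt[OF convex_convex_hull])
      (use that hull_mono[of "{a, b}" "{a, b, v}" convex] in \<open>auto intro: hull_inc\<close>)
  have e: "e s \<in> convex hull {a, b}" if "s \<in> {0<..<1}" for s
    unfolding e_def using that by (intro convexD_alt[OF convex_convex_hull]) (auto intro: hull_inc)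
  have d1e: "d1 (e s) \<in> T1 \<inter> T2" "?c1 (d1 (e s)) = e s" if "s \<in> {0<..<1}" for s
    using e[OF that] d1(2) unfolding abv(3)[symmetric] by auto
  have f: "f s \<in> convex hull {a', b'}" if "s \<in> {0<..<1}" for s
    unfolding f_def abw(3)[symmetric] using d1e(1)[OF that] by blast
  have p: "d1 (p z) \<in> T1" "?c1 (d1 (p z)) = p z" if "z \<in> W" "0 \<le> snd z" for z
  proof -
    have "p z \<in> ?c1 ` T1"
      unfolding abv(2) p_def using that by (intro cone e) (auto simp: W_def)
    then show "d1 (p z) \<in> T1" "?c1 (d1 (p z)) = p z"
      using d1(2) by auto
  qed
  have qK: "q z \<in> ?c2 ` T2" if "z \<in> W" "snd z \<le> 0" for z
    unfolding abw(2) q_def using that by (intro cone f) (auto simp: W_def)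
  have q: "d2 (q z) \<in> T2" "?c2 (d2 (q z)) = q z" if "z \<in> W" "snd z \<le> 0" for z
    using qK[OF that] d2(2) by auto
  have e_inj: "s = s'" if "e s = e s'" for s s'
  proof -
    have "(s - s') *\<^sub>R (b - a) = e s - e s'"
      by (simp add: e_def algebra_simps)
    then show ?thesis
      using that abv(1) by auto
  qed
  have ce: "continuous_on S e" for S
    unfolding e_def by (intro continuous_intros)
  have cf: "continuous_on {0<..<1} f"
  proof -
    have "continuous_map (top_of_set {0<..<1}) (top_of_set (?c1 ` T1)) e"
      using ce e abv(3) by (auto simp: continuous_map_in_subtopology)
    from continuous_map_compose[OF this d1(1)]
    have "continuous_map (top_of_set {0<..<1}) (subtopology (topo M) T2) (d1 \<circ> e)"
      using d1e(1) by (auto simp: continuous_map_in_subtopology)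
    from continuous_map_compose[OF this homeomorphic_imp_continuous_map[OF homeomorphic_chart[OF T(2)]]]
    have "continuous_map (top_of_set {0<..<1}) euclidean (?c2 \<circ> (d1 \<circ> e))"
      using continuous_map_into_fulltopology by blast
    then show ?thesis
      unfolding f_def[abs_def] by (simp add: o_def)
  qed
  have "continuous_map (top_of_set W) (topo M) G"
    unfolding G_def
  proof (rule continuous_map_cases_le)
    show "continuous_map (top_of_set W) euclideanreal (\<lambda>z. 0)" "continuous_map (top_of_set W) euclideanreal snd"
      by (auto intro: continuous_on_snd)
    let ?W1 = "{z \<in> topspace (top_of_set W). 0 \<le> snd z}"
    have "continuous_on (W \<inter> ?W1) p"
      unfolding p_def by (intro continuous_intros continuous_on_compose2[OF ce[of UNIV]]) auto
    moreover have "p ` (W \<inter> ?W1) \<subseteq> ?c1 ` T1"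
      using p by force
    ultimately have "continuous_map (top_of_set (W \<inter> ?W1)) (top_of_set (?c1 ` T1)) p"
      by (auto simp: continuous_map_in_subtopology)
    from continuous_map_compose[OF this d1(1)]
    show "continuous_map (subtopology (top_of_set W) ?W1) (topo M) (\<lambda>z. d1 (p z))"
      by (simp add: subtopology_subtopology o_def)
    let ?W2 = "{z \<in> topspace (top_of_set W). snd z \<le> 0}"
    have "continuous_on (W \<inter> ?W2) q"
      unfolding q_def by (intro continuous_intros continuous_on_compose2[OF cf]) (auto simp: W_def)
    moreover have "q ` (W \<inter> ?W2) \<subseteq> ?c2 ` T2"
      using qK by auto
    ultimately have "continuous_map (top_of_set (W \<inter> ?W2)) (top_of_set (?c2 ` T2)) q"
      by (auto simp: continuous_map_in_subtopology)
    from continuous_map_compose[OF this d2(1)]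
    show "continuous_map (subtopology (top_of_set W) ?W2) (topo M) (\<lambda>z. d2 (q z))"
      by (simp add: subtopology_subtopology o_def)
    show "d1 (p z) = d2 (q z)" if "z \<in> topspace (top_of_set W)" "0 = snd z" for z
      using that d1e(1)[of "fst z"] d2(2) by (auto simp: p_def q_def f_def W_def)
  qed
  moreover have "inj_on G W"
  proof -
    have same1: "z = z'" if z: "z \<in> W" "0 \<le> snd z" "z' \<in> W" "0 \<le> snd z'" "d1 (p z) = d1 (p z')" for z z'
    proof -
      have "p z = p z'"
        using p(2) z by metis
      then have "snd z = snd z' \<and> e (fst z) = e (fst z')"
        using z(1,3) unfolding p_def by (intro triangle_cone_unique[OF abv(1)] e) (auto simp: W_def)
      then show ?thesis
        using e_inj prod_eq_iff by blast
    qed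
    have same2: "z = z'" if z: "z \<in> W" "snd z < 0" "z' \<in> W" "snd z' < 0" "d2 (q z) = d2 (q z')" for z z'
    proof -
      have "q z = q z'"
        using q(2) z less_imp_le by metis
      then have sf: "- snd z = - snd z' \<and> f (fst z) = f (fst z')"
        using z(1,3) unfolding q_def by (intro triangle_cone_unique[OF abw(1)] f) (auto simp: W_def)
      have fst: "fst z \<in> {0<..<1}" "fst z' \<in> {0<..<1}"
        using z(1,3) by (auto simp: W_def)
      have "d1 (e (fst z)) = d1 (e (fst z'))"
        using sf d1e(1) fst inj_onD[OF inj_on_chart[OF T(2)]] unfolding f_def by blast
      then have "e (fst z) = e (fst z')"
        using d1e(2) fst by metis
      then show ?thesis
        using sf e_inj by (simp add: prod_eq_iff)
    qed
    \<comment> \<open>A point reached from both sides lies in \<open>T1 \<inter> T2\<close>, hence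
      on the edge, so it also has cone coordinates of height 0, against their uniqueness.\<close>
    have mixed: "d1 (p z) \<noteq> d2 (q z')" if z: "z \<in> W" "0 \<le> snd z" "z' \<in> W" "snd z' < 0" for z z'
    proof
      assume eq: "d1 (p z) = d2 (q z')"
      then have "d2 (q z') \<in> T1 \<inter> T2"
        using p(1)[OF z(1,2)] q(1)[OF z(3)] z(4) by simp
      then have "?c2 (d2 (q z')) \<in> convex hull {a', b'}"
        unfolding abw(3)[symmetric] by blast
      then have q': "q z' \<in> convex hull {a', b'}"
        using q(2)[OF z(3)] z(4) by simp
      have "(1 - (- snd z')) *\<^sub>R f (fst z') + (- snd z') *\<^sub>R w = (1 - 0) *\<^sub>R q z' + 0 *\<^sub>R w"
        unfolding q_def by simp
      then have "- snd z' = 0 \<and> f (fst z') = q z'"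
        using z(3) q' by (intro triangle_cone_unique[OF abw(1)] f) (auto simp: W_def)
      then show False
        using z(4) by simp
    qed
    show ?thesis
    proof (rule inj_onI)
      fix z z' assume z: "z \<in> W" "z' \<in> W" "G z = G z'"
      show "z = z'"
        using z same1[of z z'] same2[of z z'] mixed[of z z'] mixed[of z' z]
        unfolding G_def by (metis not_le)
    qed
  qed
  moreover have "open W"
    unfolding W_def by (intro open_Times open_greaterThanLessThan)
  ultimately have "openin (topo M) (G ` W)"
    by (intro surface_invariance_of_domain[OF topological_surface_topo]) auto
  moreover have "x \<in> G ` W"
  proof
    show "(s0, 0) \<in> W"
      using s0 by (simp add: W_def)
    have "G (s0, 0) = d1 (?c1 x)"
      unfolding s0(3) by (simp add: G_def p_def e_def)
    then show "x = G (s0, 0)"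
      using d1(2) x(1) by simp
  qed
  moreover have "G ` W \<subseteq> T1 \<union> T2"
    using p(1) q(1) by (auto simp: G_def)
  ultimately show ?thesis
    by (rule that)
qed

text \<open>Two triangles that meet only in a vertex cannot share \<open>x\<close>, so they have a
  common edge. A third triangle at \<open>x\<close> would have interior points in the neighbourhood
  covered by \<open>T1\<close> and \<open>T2\<close>, although interior points lie in no other
  triangle.\<close>

lemma star_edge_point:
  assumes x: "\<not> is_vertex M x" and T: "T1 \<in> star M x" "T2 \<in> star M x" "T1 \<noteq> T2"
  shows "share_edge M T1 T2" "star M x = {T1, T2}"
proof -
  have T': "T1 \<in> triangles M" "T2 \<in> triangles M" "x \<in> T1" "x \<in> T2"
    using T(1,2) unfolding star_def by blast+
  have nv: "\<not> vertex_of M T1 x"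
    using x T'(1) unfolding is_vertex_def by blast
  have "\<not> share_vertex M T1 T2"
  proof
    assume "share_vertex M T1 T2"
    then obtain z where "T1 \<inter> T2 = {z}" "vertex_of M T1 z"
      unfolding share_vertex_def by blast
    then show False
      using nv T'(3,4) by (metis IntI singletonD)
  qed
  then show se: "share_edge M T1 T2"
    using triangles_meet[OF T'(1,2) T(3) T'(3,4)] by simp
  obtain N where N: "openin (topo M) N" "x \<in> N" "N \<subseteq> T1 \<union> T2"
    by (rule share_edge_nbhd[OF T'(1,2) se IntI[OF T'(3,4)] nv])
  have "T \<in> {T1, T2}" if T: "T \<in> star M x" for T
  proof (rule ccontr)
    assume ne: "T \<notin> {T1, T2}"
    have T3: "T \<in> triangles M" "x \<in> T"
      using T by (auto simp: star_def)
    obtain y where "y \<in> N" "y \<in> T" "chart M T y \<in> interior (chart M T ` T)"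
      by (rule interior_point_near[OF T3 N(1,2)])
    then show False
      using N(3) common_point_not_interior[OF T3(1) T'(1)] common_point_not_interior[OF T3(1) T'(2)] ne
      by blast
  qed
  then show "star M x = {T1, T2}"
    using T by blast
qed

text \<open>Some neighbourhood of \<open>x\<close> lies inside \<open>T\<close>, and its image under
  the chart is open in the plane because the surface is locally planar. This is where the absence of
  a boundary of the surface enters.\<close>

lemma star_interior_point:
  assumes "star M x = {T}"
  shows "chart M T x \<in> interior (chart M T ` T)"
proof -
  have "T \<in> star M x"
    using assms by simp
  then have T: "T \<in> triangles M" "x \<in> T"
    by (simp_all add: star_def)
  then have "x \<in> topspace (topo M)"
    using triangle_subset by blast
  then obtain N where N: "openin (topo M) N" "x \<in> N" "N \<subseteq> \<Union> (star M x)"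
    by (rule nbhd_subset_star)
  then have N': "N \<subseteq> T"
    using assms by simp
  have "continuous_map (subtopology (topo M) T) euclidean (chart M T)"
    using homeomorphic_imp_continuous_map[OF homeomorphic_chart[OF T(1)]]
    by (rule continuous_map_into_fulltopology)
  then have cont: "continuous_map (subtopology (topo M) N) euclidean (chart M T)"
    using N' by (rule continuous_map_from_subtopology_mono)
  have "inj_on (chart M T) N"
    using inj_on_chart[OF T(1)] N' by (rule inj_on_subset)
  with topological_surface_topo N(1) cont have "open (chart M T ` N)"
    by (rule surface_open_image)
  moreover have "chart M T x \<in> chart M T ` N" "chart M T ` N \<subseteq> chart M T ` T"
    using N(2) N' by blast+
  ultimately show ?thesis
    by (rule interiorI)
qed

end

section \<open>Constancy of the length\<close>

text \<open>The candidate for the constant, attached to a triangle instead of a point so that it can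
  be compared across edges.\<close>

definition total_length :: "'a pf_surface \<Rightarrow> 'a set \<Rightarrow> real" where
  "total_length M T = arc_length (fnorm M T) {v. fnorm M T v = 1}"

text \<open>The class of every outgoing unit vector belongs to \<open>S_out M x\<close> by
  construction, so the gluing leaves no trace in the total length.\<close>

lemma l_out_S_out: "l_out M x (S_out M x) = (\<Sum>T\<in>star M x. arc_length (fnorm M T) (out_ind M x T))"
  unfolding l_out_def
proof (rule sum.cong)
  fix T assume "T \<in> star M x"
  then have "glue M x `` {(T, v)} \<in> S_out M x" if "v \<in> out_ind M x T" for v
    using that unfolding S_out_def by (intro quotientI) simp
  then have "{v \<in> out_ind M x T. glue M x `` {(T, v)} \<in> S_out M x} = out_ind M x T"
    by blast
  then show "arc_length (fnorm M T) {v \<in> out_ind M x T. glue M x `` {(T, v)} \<in> S_out M x} =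
      arc_length (fnorm M T) (out_ind M x T)"
    by (rule arg_cong)
qed (rule refl)

lemma l_in_S_in: "l_in M x (S_in M x) = (\<Sum>T\<in>star M x. arc_length (fnorm M T) (in_ind M x T))"
  unfolding l_in_def
proof (rule sum.cong)
  fix T assume "T \<in> star M x"
  then have "glue M x `` {(T, v)} \<in> S_in M x" if "v \<in> in_ind M x T" for v
    using that unfolding S_in_def by (intro quotientI) simp
  then have "{v \<in> in_ind M x T. glue M x `` {(T, v)} \<in> S_in M x} = in_ind M x T"
    by blast
  then show "arc_length (fnorm M T) {v \<in> in_ind M x T. glue M x `` {(T, v)} \<in> S_in M x} =
      arc_length (fnorm M T) (in_ind M x T)"
    by (rule arg_cong)
qed (rule refl)

context
  fixes M :: "'a pf_surface"
  assumes L: "pf_landsberg_surface M"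
begin

lemma landsberg_finsler: "pf_finsler_surface M"
  using L unfolding pf_landsberg_surface_def by (rule conjunct1)

lemma interior_point_lengths:
  assumes "star M x = {T}"
  shows "l_out M x (S_out M x) = total_length M T" "l_in M x (S_in M x) = total_length M T"
proof -
  have "tcone M x T = UNIV"
    by (rule tcone_interior[OF star_interior_point[OF landsberg_finsler assms]])
  then show "l_out M x (S_out M x) = total_length M T" "l_in M x (S_in M x) = total_length M T"
    unfolding l_out_S_out l_in_S_in assms total_length_def out_ind_def in_ind_def by simp_all
qed

text \<open>A vector \<open>v\<close> is incoming if \<open>- v\<close> lies in the cone, which
  replaces the normal \<open>n\<close> by \<open>- n\<close>. The two halves therefore make up the
  indicatrix and overlap only on the line of the edge.\<close>

lemma half_indicatrices:
  assumes x: "\<not> is_vertex M x" and T: "T \<in> triangles M" "is_edge_of M T E" "x \<in> E"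
  obtains n where "n \<noteq> 0" "out_ind M x T = {v. fnorm M T v = 1 \<and> 0 \<le> n \<bullet> v}"
    "in_ind M x T = {v. fnorm M T v = 1 \<and> 0 \<le> (- n) \<bullet> v}"
proof -
  have "\<not> vertex_of M T x"
    using x T(1) unfolding is_vertex_def by blast
  then obtain n where n: "n \<noteq> 0" "tcone M x T = {v. 0 \<le> n \<bullet> v}"
    by (rule tcone_edge[OF landsberg_finsler T])
  show ?thesis
    by (rule that[OF n(1)]) (auto simp: out_ind_def in_ind_def n(2))
qed

lemma arc_length_in_out:
  assumes x: "\<not> is_vertex M x" and T: "T1 \<in> star M x" "T2 \<in> star M x" "T1 \<noteq> T2"
  shows "arc_length (fnorm M T1) (in_ind M x T1) = arc_length (fnorm M T2) (out_ind M x T2)"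
    and "arc_length (fnorm M T1) (in_ind M x T1) + arc_length (fnorm M T1) (out_ind M x T1) =
      total_length M T1"
proof -
  have T': "T1 \<in> triangles M" "T2 \<in> triangles M" "x \<in> T1 \<inter> T2"
    using T unfolding star_def by blast+
  note se = star_edge_point(1)[OF landsberg_finsler x T]
  then have e: "is_edge_of M T1 (T1 \<inter> T2)" "is_edge_of M T2 (T1 \<inter> T2)"
    unfolding share_edge_def by blast+
  obtain n1 where n1: "n1 \<noteq> 0" "out_ind M x T1 = {v. fnorm M T1 v = 1 \<and> 0 \<le> n1 \<bullet> v}"
    "in_ind M x T1 = {v. fnorm M T1 v = 1 \<and> 0 \<le> (- n1) \<bullet> v}"
    by (rule half_indicatrices[OF x T'(1) e(1) T'(3)])
  obtain n2 where n2: "n2 \<noteq> 0" "out_ind M x T2 = {v. fnorm M T2 v = 1 \<and> 0 \<le> n2 \<bullet> v}"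
    "in_ind M x T2 = {v. fnorm M T2 v = 1 \<and> 0 \<le> (- n2) \<bullet> v}"
    by (rule half_indicatrices[OF x T'(2) e(2) T'(3)])
  note mink = minkowski_norm_triangle[OF landsberg_finsler T'(1)]
    minkowski_norm_triangle[OF landsberg_finsler T'(2)]
  have "\<forall>T1\<in>triangles M. \<forall>T2\<in>triangles M. share_edge M T1 T2 \<longrightarrow>
        (\<forall>x\<in>T1 \<inter> T2. \<not> is_vertex M x \<longrightarrow>
           (\<exists>h. (\<forall>u\<in>in_ind M x T1. \<forall>v1 v2. edge_vec M x T1 T2 v1 v2 \<and> v1 \<noteq> 0 \<longrightarrow>
                   fund (fnorm M T1) u u v1 = fund (fnorm M T2) (h u) (h u) v2) \<and>
                indicatrix_isometry (fnorm M T1) (in_ind M x T1)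
                  (fnorm M T2) (out_ind M x T2) h))"
    using L unfolding pf_landsberg_surface_def by (rule conjunct2)
  from bspec[OF bspec[OF this T'(1)] T'(2)] se T'(3) x
  obtain h where h: "indicatrix_isometry (fnorm M T1) (in_ind M x T1) (fnorm M T2) (out_ind M x T2) h"
    by blast
  have "- n1 \<noteq> 0"
    using n1(1) by simp
  from indicatrix_isometry_arc_length[OF mink this n2(1) h[unfolded n1(3) n2(2)]]
  show "arc_length (fnorm M T1) (in_ind M x T1) = arc_length (fnorm M T2) (out_ind M x T2)"
    unfolding n1(3) n2(2) .
  show "arc_length (fnorm M T1) (in_ind M x T1) + arc_length (fnorm M T1) (out_ind M x T1) =
      total_length M T1"
    using arc_length_split[OF mink(1) n1(1)] unfolding n1(2,3) total_length_def by simp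
qed

text \<open>Let \<open>in1\<close>, \<open>out1\<close>, \<open>in2\<close>, \<open>out2\<close> be
  the lengths of the halves. Both orders of the triangles in the Landsberg condition give
  \<open>in1 = out2\<close> and \<open>in2 = out1\<close>. So \<open>out1 + out2\<close> and
  \<open>in1 + in2\<close> both equal \<open>in1 + out1\<close>, which is also
  \<open>out2 + in2\<close>.\<close>

lemma edge_point_lengths:
  assumes x: "\<not> is_vertex M x" and T: "T1 \<in> star M x" "T2 \<in> star M x" "T1 \<noteq> T2"
  shows "l_out M x (S_out M x) = total_length M T1" "l_in M x (S_in M x) = total_length M T1"
    "total_length M T1 = total_length M T2"
proof -
  note a = arc_length_in_out[OF x T] arc_length_in_out[OF x T(2,1) T(3)[symmetric]]
  have "star M x = {T1, T2}"
    by (rule star_edge_point(2)[OF landsberg_finsler x T])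
  with T(3) a show "l_out M x (S_out M x) = total_length M T1"
    "l_in M x (S_in M x) = total_length M T1" "total_length M T1 = total_length M T2"
    unfolding l_out_S_out l_in_S_in by simp_all
qed

lemma point_lengths:
  assumes x: "\<not> is_vertex M x" and T: "T \<in> star M x"
  shows "l_out M x (S_out M x) = total_length M T" "l_in M x (S_in M x) = total_length M T"
proof -
  have "l_out M x (S_out M x) = total_length M T \<and> l_in M x (S_in M x) = total_length M T"
  proof (cases "star M x = {T}")
    case True
    then show ?thesis
      using interior_point_lengths by blast
  next
    case False
    then obtain T' where "T' \<in> star M x" "T \<noteq> T'"
      using T by blast
    from edge_point_lengths(1,2)[OF x T this] show ?thesis ..
  qed
  then show "l_out M x (S_out M x) = total_length M T" "l_in M x (S_in M x) = total_length M T"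
    by blast+
qed

section \<open>From neighbouring triangles to the whole surface\<close>

lemma isolated_vertices:
  assumes v: "v \<in> topspace (topo M)"
  obtains Q where "openin (topo M) Q" "v \<in> Q" "\<And>y. y \<in> Q - {v} \<Longrightarrow> \<not> is_vertex M y"
proof -
  note F = landsberg_finsler
  obtain V where V: "openin (topo M) V" "v \<in> V" "finite {T \<in> triangles M. T \<inter> V \<noteq> {}}"
    using locally_finite_triangles[OF F] v unfolding locally_finite_in_def by blast
  have fin: "finite {y. vertex_of M T y}" if T: "T \<in> triangles M" for T
  proof -
    obtain C where C: "finite C" "chart M T ` T = convex hull C"
      using simplex_chart[OF F T] unfolding simplex by blast
    have "chart M T ` {y. vertex_of M T y} \<subseteq> C"
      using extreme_point_of_convex_hull C(2) unfolding vertex_of_def by fastforce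
    then have "finite (chart M T ` {y. vertex_of M T y})"
      using C(1) by (rule finite_subset)
    moreover have "inj_on (chart M T) {y. vertex_of M T y}"
      by (rule inj_on_subset[OF inj_on_chart[OF F T]]) (auto simp: vertex_of_def)
    ultimately show ?thesis
      by (rule finite_imageD)
  qed
  \<comment> \<open>The vertices of the finitely many triangles that meet \<open>V\<close>. Being
    finite, the set is closed even after \<open>v\<close> is taken out of it, so it can be cut away
    from \<open>V\<close>.\<close>
  define R where "R = (\<Union>T\<in>{T \<in> triangles M. T \<inter> V \<noteq> {}}. {y. vertex_of M T y})"
  have "finite R"
    unfolding R_def using V(3) fin by (intro finite_UN_I) auto
  moreover have "R \<subseteq> topspace (topo M)"
    using triangle_subset[OF F] unfolding R_def vertex_of_def by blast
  ultimately have "closedin (topo M) (R - {v})"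
    using topological_surface_topo[OF F] unfolding topological_surface_def
    by (intro closedin_Hausdorff_finite) auto
  then have "openin (topo M) (V - (R - {v}))"
    using V(1) by (rule openin_diff[rotated])
  moreover have "v \<in> V - (R - {v})"
    using V(2) by blast
  moreover have "\<not> is_vertex M y" if "y \<in> V - (R - {v}) - {v}" for y
  proof
    assume "is_vertex M y"
    then obtain T where "T \<in> triangles M" "vertex_of M T y"
      unfolding is_vertex_def by blast
    then have "y \<in> R"
      using that unfolding R_def vertex_of_def by blast
    then show False
      using that by blast
  qed
  ultimately show ?thesis
    using that by metis
qed

text \<open>The union of the triangles of a given length and the union of the others are closed and can
  only meet in vertices; a common vertex would disconnect its punctured disc neighbourhoods.\<close>

lemma total_length_constant:
  assumes conn: "connected_space (topo M)" and T: "T1 \<in> triangles M" "T2 \<in> triangles M"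
  shows "total_length M T1 = total_length M T2"
proof (rule ccontr)
  note F = landsberg_finsler
  assume ne: "total_length M T1 \<noteq> total_length M T2"
  define \<A> where "\<A> = {T \<in> triangles M. total_length M T = total_length M T1}"
  define \<B> where "\<B> = {T \<in> triangles M. total_length M T \<noteq> total_length M T1}"
  have sub: "\<A> \<subseteq> triangles M" "\<B> \<subseteq> triangles M"
    by (auto simp: \<A>_def \<B>_def)
  have cl: "closedin (topo M) (\<Union> \<A>)" "closedin (topo M) (\<Union> \<B>)"
    by (intro closedin_Union_triangles[OF F] sub)+
  have cover: "topspace (topo M) = \<Union> \<A> \<union> \<Union> \<B>"
    unfolding Union_triangles[OF F, symmetric] by (auto simp: \<A>_def \<B>_def)
  have nonempty: "T \<noteq> {}" if "T \<in> triangles M" for T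
    using interior_2_simplex[OF simplex_chart[OF F that]] by force
  have "\<Union> \<A> \<noteq> {}"
    using nonempty[OF T(1)] T(1) unfolding \<A>_def by blast
  moreover have "T2 \<in> \<B>"
    using T(2) ne by (simp add: \<B>_def)
  then have "\<Union> \<B> \<noteq> {}"
    using nonempty[OF T(2)] by blast
  \<comment> \<open>A connected space is not the union of two disjoint nonempty closed sets. Whether
    the common point \<open>v\<close> is a vertex need not be known; the punctured disc around it
    handles both cases.\<close>
  ultimately have "\<Union> \<A> \<inter> \<Union> \<B> \<noteq> {}"
    using conn cl cover unfolding connected_space_closedin_eq by metis
  then obtain v P Q where v: "P \<in> \<A>" "Q \<in> \<B>" "v \<in> P" "v \<in> Q"
    by blast
  then have PQ: "P \<in> triangles M" "Q \<in> triangles M" "P \<noteq> Q"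
    by (auto simp: \<A>_def \<B>_def)
  have "v \<in> topspace (topo M)"
    using triangle_subset[OF F PQ(1)] v(3) by blast
  then obtain N where N: "openin (topo M) N" "v \<in> N" "\<And>y. y \<in> N - {v} \<Longrightarrow> \<not> is_vertex M y"
    using isolated_vertices by metis
  obtain D where D: "openin (topo M) D" "v \<in> D" "D \<subseteq> N" "connectedin (topo M) (D - {v})"
    by (rule surface_punctured_nbhd[OF topological_surface_topo[OF F] N(1,2)])
  \<comment> \<open>Within \<open>D\<close>, any common point other than \<open>v\<close> is not a
    vertex, so its two triangles have equal total length by the edge case.\<close>
  have disj: "\<Union> \<A> \<inter> \<Union> \<B> \<inter> (D - {v}) = {}"
  proof (rule ccontr)
    assume "\<Union> \<A> \<inter> \<Union> \<B> \<inter> (D - {v}) \<noteq> {}"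
    then obtain y S S' where y: "y \<in> D - {v}" "S \<in> \<A>" "S' \<in> \<B>" "y \<in> S" "y \<in> S'"
      by blast
    then have "S \<in> star M y" "S' \<in> star M y" "S \<noteq> S'"
      by (auto simp: \<A>_def \<B>_def star_def)
    moreover have "\<not> is_vertex M y"
      using N(3) y(1) D(3) by blast
    ultimately have "total_length M S = total_length M S'"
      using edge_point_lengths(3) by blast
    then show False
      using y(2,3) by (simp add: \<A>_def \<B>_def)
  qed
  \<comment> \<open>Both unions reach \<open>D\<close> away from \<open>v\<close>, through interior
    points of \<open>P\<close> and of \<open>Q\<close> near \<open>v\<close>; these differ from
    \<open>v\<close> because \<open>v\<close> lies in two triangles.\<close>
  have meets: "\<Union> \<C> \<inter> (D - {v}) \<noteq> {}"
    if T: "T \<in> \<C>" "T \<in> triangles M" "T' \<in> triangles M" "T \<noteq> T'" "v \<in> T" "v \<in> T'" for \<C> T T'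
  proof -
    obtain y where y: "y \<in> D" "y \<in> T" "chart M T y \<in> interior (chart M T ` T)"
      by (rule interior_point_near[OF F T(2,5) D(1,2)])
    have "y \<noteq> v"
      using y(3) common_point_not_interior[OF F T(2-6)] by blast
    then show ?thesis
      using y(1,2) T(1) by blast
  qed
  have "\<Union> \<A> \<inter> (D - {v}) \<noteq> {}"
    by (rule meets[OF v(1) PQ v(3,4)])
  moreover have "\<Union> \<B> \<inter> (D - {v}) \<noteq> {}"
    by (rule meets[OF v(2) PQ(2,1) PQ(3)[symmetric] v(4,3)])
  moreover have "D - {v} \<subseteq> \<Union> \<A> \<union> \<Union> \<B>"
    using openin_subset[OF D(1)] cover by blast
  ultimately show False
    using D(4) cl disj unfolding connectedin_closedin by blast
qed

end

theorem lemma7p1: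
  fixes M :: "'a pf_surface"
  assumes "pf_landsberg_surface M"
    and "connected_space (topo M)"
  shows "\<exists>\<theta>::real. \<forall>x\<in>topspace (topo M). \<not> is_vertex M x \<longrightarrow>
           l_out M x (S_out M x) = \<theta> \<and> l_in M x (S_in M x) = \<theta>"
proof (cases "triangles M = {}")
  \<comment> \<open>The surface is then empty and any number serves.\<close>
  case True
  then show ?thesis
    using Union_triangles[OF landsberg_finsler[OF assms(1)]] by simp
next
  case False
  then obtain T0 where T0: "T0 \<in> triangles M"
    by blast
  have "l_out M x (S_out M x) = total_length M T0 \<and> l_in M x (S_in M x) = total_length M T0"
    if x: "x \<in> topspace (topo M)" "\<not> is_vertex M x" for x
  proof -
    obtain T where T: "T \<in> triangles M" "x \<in> T"
      using x(1) Union_triangles[OF landsberg_finsler[OF assms(1)]] by blast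
    then have "T \<in> star M x"
      by (simp add: star_def)
    then show ?thesis
      using point_lengths[OF assms(1) x(2)] total_length_constant[OF assms T(1) T0] by simp
  qed
  then show ?thesis
    by blast
qed

end
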